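(* Let $p\in\mathbb{Z}^+$ and let $n_0=\lceil\log_2(8p)\rceil$. There exists a constant $C_S>0$, depending only on $p$, such that for all integers $n\ge n_0$, all $\varphi\in L^2(\Delta)$ and all $\delta\in\widehat{\mathrm{T}}_n$ we have $$\left\|\Pi_{\widehat{\mathcal W}_n}\varphi\right\|_{L^2(\delta)}\le C_S\,\|\varphi\|_{L^2(\tilde\delta)},$$ where $\widehat{\mathrm T}_n$ is the hierarchical mesh on the triangle $\Delta$, $\Pi_{\widehat{\mathcal W}_n}$ is the projection onto the hierarchical spline space $\widehat{\mathcal W}_n$ and $\tilde\delta$ is the support extension of $\delta$, all defined in the context.
   Context: Fix a degree $p\in\mathbb{Z}^+$. For $n\in\mathbb{Z}_{\ge0}$ put $h=2^{-n}$. B-splines. $b^n_i(s)$, $i=1,\dots,2^n+p$, are the standard degree-$p$ B-splines (normalized to a partition of unity) on $]0,1[$ for the open knot vector with simple interior knots $h,2h,\dots,1-h$ and the end knots $0$ and $1$ repeated $p+1$ times. $B^d_j(t)=\binom{d}{j-1}t^{j-1}(1-t)^{d-j+1}$, $j=1,\dots,d+1$, is the $j$-th Bernstein polynomial of degree $d$. Triangle and singular map. For $\gamma>0$, $\Delta_\gamma=\{(u,v):0<u<\gamma,\ 0<v<u\}$ and $\Delta=\Delta_1$. The map $\mathbf u:\,]0,1[^2\to\Delta$ is $\mathbf u(s,t)=(s,st)$, with inverse $\mathbf u^{-1}(u,v)=(u,v/u)$. For $c\in\mathbb R$, $c\mathbf I$ denotes the map $(u,v)\mapsto(cu,cv)$.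 Mesh. $\mathrm T_n$ is the set of open cells $\mathbf u\big(](a-1)h,ah[\times](c-1)h,ch[\big)$, $1\le a,c\le 2^n$. Set $\widehat{\mathrm T}_0=\{\Delta\}$ and, for $n\ge1$, $\widehat{\mathrm T}_n=\{\delta\in\mathrm T_n:\delta\subseteq\Delta\setminus\Delta_{1/2}\}\cup\{\delta/2:\delta\in\widehat{\mathrm T}_{n-1}\}$, where $\delta/2=\{(u/2,v/2):(u,v)\in\delta\}$. Space. The index set and functions $\hat b^n_{i,j}$ on $]0,1[^2$ are: $\hat b^n_{i,j}(s,t)=b^n_i(s)B^{i-1}_j(t)$ for $1\le i\le p+1$, $1\le j\le i$; and, for each $m=1,\dots,n$, $\hat b^n_{i,j}(s,t)=b^n_i(s)b^m_j(t)$ for $p+2^{m-1}+1\le i\le p+2^m$, $1\le j\le p+2^m$. Put $\beta^n_{i,j}=\hat b^n_{i,j}\circ\mathbf u^{-1}$ and $\widehat{\mathcal W}_n=\mathrm{span}\{\beta^n_{i,j}\}$. Dual functionals. $\lambda^n_k:L^2(0,1)\to\mathbb R$, $k=1,\dots,2^n+p$, is the standard ($L^2$-bounded, locally supported) dual basis for univariate B-splines: $\lambda^n_k(b^n_i)=\delta^k_i$ (Kronecker delta) and $|\lambda^n_k(f)|\le C_p|I|^{-1/2}\|f\|_{L^2(I)}$ with $I=\mathrm{supp}\,b^n_k$ and $C_p$ depending only on $p$. Let $n_0=\lceil\log_2(8p)\rceil$, $h_0=2^{-n_0}$. Let $\mu^{n_0}_{k,l}:L^2(\Delta_{h_0})\to\mathbb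 R$, $k=1,\dots,p+1$, $l=1,\dots,k$, be bounded linear functionals, fixed once for each $p$, with $\mu^{n_0}_{k,l}(\beta^{n_0}_{i,j}|_{\Delta_{h_0}})=\delta^k_i\delta^l_j$. For $n\ge n_0$ and $\varphi\in L^2(\Delta)$ set $\Lambda^n_{k,l}(\varphi)=\mu^{n_0}_{k,l}(\varphi\circ(2^{n_0-n}\mathbf I))$ for $1\le k\le p+1$, $1\le l\le k$, and $\Lambda^n_{k,l}(\varphi)=(\lambda^n_k\otimes\lambda^{m(k)}_l)(\varphi\circ\mathbf u)$ for $p+2\le k\le 2^n+p$, $1\le l\le 2^{m(k)}+p$, where $m(k)=\lceil\log_2(k-p)\rceil$ ($\lambda^n_k$ acts in $s$, $\lambda^{m(k)}_l$ acts in $t$; the tensor product functional only uses values on the support of $b^n_k(s)b^{m(k)}_l(t)$, which is bounded away from $s=0$). Projection. $\Pi_{\widehat{\mathcal W}_n}(\varphi)=\sum_{k=1}^{2^n+p}\sum_l\Lambda^n_{k,l}(\varphi)\,\beta^n_{k,l}$, with $l$ running over all admissible indices for $k$. Support extension. For $\delta\in\widehat{\mathrm T}_n$, $\tilde\delta$ is the (interior of the) union of the supports of all basis functions $\beta^n_{i,j}$ that do not vanish identically on $\delta$. *)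

theory Defs
  imports "HOL-Analysis.Analysis"
begin

section \<open>Square-integrable functions\<close>

text \<open>Elements of $L^2(S)$ are represented by functions defined everywhere; only their values on
  $S$, up to null sets, matter. Functionals are required below to be linear and bounded in terms
  of the $L^2$ norm, so they respect equality almost everywhere.\<close>

definition L2 :: "'a::euclidean_space set \<Rightarrow> ('a \<Rightarrow> real) set" where
  "L2 S = {f. f \<in> borel_measurable (lebesgue_on S) \<and> integrable (lebesgue_on S) (\<lambda>x. (f x)\<^sup>2)}"

text \<open>The integral is \<open>0\<close> for non-integrable functions, so this is the norm only on
  \<^term>\<open>L2 S\<close>.\<close>

definition L2_norm :: "'a::euclidean_space set \<Rightarrow> ('a \<Rightarrow> real) \<Rightarrow> real" where
  "L2_norm S f = sqrt (integral\<^sup>L (lebesgue_on S) (\<lambda>x. (f x)\<^sup>2))"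

definition linear_on_L2 :: "'a::euclidean_space set \<Rightarrow> (('a \<Rightarrow> real) \<Rightarrow> real) \<Rightarrow> bool" where
  "linear_on_L2 S F \<longleftrightarrow>
     (\<forall>f\<in>L2 S. \<forall>g\<in>L2 S. \<forall>a b. F (\<lambda>x. a * f x + b * g x) = a * F f + b * F g)"

text \<open>Support relative to the domain of definition.\<close>

definition supp_in :: "'a::topological_space set \<Rightarrow> ('a \<Rightarrow> real) \<Rightarrow> 'a set" where
  "supp_in S f = S \<inter> closure {x \<in> S. f x \<noteq> 0}"


section \<open>Univariate B-splines\<close>

text \<open>Used for indices from \<open>1\<close> to \<open>2^n + 2 p + 1\<close>.\<close>

definition open_knot :: "nat \<Rightarrow> nat \<Rightarrow> nat \<Rightarrow> real" where
  "open_knot p n i =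
     (if i \<le> p + 1 then 0 else if i \<le> p + 2 ^ n then real (i - p - 1) / 2 ^ n else 1)"

text \<open>Cox--de Boor recursion for the knots \<open>\<xi>\<close>; the convention that a quotient with
  denominator \<open>0\<close> is \<open>0\<close> is built into division. The half-open intervals in degree \<open>0\<close> are
  harmless since only values on the open interval from \<open>0\<close> to \<open>1\<close> are used.\<close>

fun cox_de_boor :: "(nat \<Rightarrow> real) \<Rightarrow> nat \<Rightarrow> nat \<Rightarrow> real \<Rightarrow> real" where
  "cox_de_boor \<xi> 0 i s = (if \<xi> i \<le> s \<and> s < \<xi> (i + 1) then 1 else 0)"
| "cox_de_boor \<xi> (Suc d) i s =
     (s - \<xi> i) / (\<xi> (i + d + 1) - \<xi> i) * cox_de_boor \<xi> d i s
   + (\<xi> (i + d + 2) - s) / (\<xi> (i + d + 2) - \<xi> (i + 1)) * cox_de_boor \<xi> d (i + 1) s"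

definition bspline :: "nat \<Rightarrow> nat \<Rightarrow> nat \<Rightarrow> real \<Rightarrow> real" where
  "bspline p n i = cox_de_boor (open_knot p n) p i"


section \<open>Triangle, singular map and hierarchical mesh\<close>

definition Delta :: "real \<Rightarrow> (real \<times> real) set" where
  "Delta \<gamma> = {(u, v). 0 < u \<and> u < \<gamma> \<and> 0 < v \<and> v < u}"

definition sing_map :: "real \<times> real \<Rightarrow> real \<times> real" where
  "sing_map = (\<lambda>(s, t). (s, s * t))"

definition sing_map_inv :: "real \<times> real \<Rightarrow> real \<times> real" where
  "sing_map_inv = (\<lambda>(u, v). (u, v / u))"

definition scale_map :: "real \<Rightarrow> real \<times> real \<Rightarrow> real \<times> real" where
  "scale_map c = (\<lambda>(u, v). (c * u, c * v))"

definition mesh :: "nat \<Rightarrow> (real \<times> real) set set" where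
  "mesh n =
     {sing_map ` ({(real a - 1) / 2 ^ n <..< real a / 2 ^ n} \<times>
                  {(real c - 1) / 2 ^ n <..< real c / 2 ^ n}) | a c :: nat.
        1 \<le> a \<and> a \<le> 2 ^ n \<and> 1 \<le> c \<and> c \<le> 2 ^ n}"

fun hier_mesh :: "nat \<Rightarrow> (real \<times> real) set set" where
  "hier_mesh 0 = {Delta 1}"
| "hier_mesh (Suc n) =
     {\<delta> \<in> mesh (Suc n). \<delta> \<subseteq> Delta 1 - Delta (1 / 2)} \<union>
     (\<lambda>\<delta>. (\<lambda>(u, v). (u / 2, v / 2)) ` \<delta>) ` hier_mesh n"


section \<open>Hierarchical spline basis\<close>

definition level :: "nat \<Rightarrow> nat \<Rightarrow> nat" where
  "level p k = nat \<lceil>log 2 (real (k - p))\<rceil>"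

lemma level_eq:
  assumes "1 \<le> m" "p + 2 ^ (m - 1) + 1 \<le> i" "i \<le> p + 2 ^ m"
  shows "level p i = m"
proof -
  define d where "d = i - p"
  have d: "2 ^ (m - 1) < d" "d \<le> 2 ^ m"
    using assms by (auto simp: d_def)
  have "0 < d"
    using d(1) by simp
  have "real (2 ^ (m - 1)) < real d" "real d \<le> real (2 ^ m)"
    using d by (simp_all only: of_nat_less_iff of_nat_le_iff)
  then have r: "2 powr real (m - 1) < real d" "real d \<le> 2 powr real m"
    by (simp_all add: powr_realpow del: of_nat_diff)
  have "real (m - 1) < log 2 (real d)"
    using r(1) \<open>0 < d\<close> by (simp add: less_log_iff)
  moreover have "log 2 (real d) \<le> real m"
    using r(2) \<open>0 < d\<close> by (simp add: log_le_iff)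
  ultimately have "\<lceil>log 2 (real d)\<rceil> = int m"
    using assms(1) by (intro ceiling_unique) (simp_all add: of_nat_diff)
  then show ?thesis
    by (simp add: level_def d_def)
qed

definition hier_index :: "nat \<Rightarrow> nat \<Rightarrow> (nat \<times> nat) set" where
  "hier_index p n =
     {(i, j). 1 \<le> i \<and> i \<le> p + 1 \<and> 1 \<le> j \<and> j \<le> i} \<union>
     (\<Union>m\<in>{1..n}. {(i, j). p + 2 ^ (m - 1) + 1 \<le> i \<and> i \<le> p + 2 ^ m \<and> 1 \<le> j \<and> j \<le> p + 2 ^ m})"

text \<open>Bernstein polynomials are indexed from \<open>0\<close> in the library, from \<open>1\<close> here. By
  \<open>level_eq\<close>, \<^term>\<open>level p i\<close> is the \<open>m\<close> for which \<open>(i, j)\<close> occurs in \<^term>\<open>hier_index p n\<close>.\<close>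

definition bhat :: "nat \<Rightarrow> nat \<Rightarrow> nat \<Rightarrow> nat \<Rightarrow> real \<times> real \<Rightarrow> real" where
  "bhat p n i j = (\<lambda>(s, t). bspline p n i s *
     (if i \<le> p + 1 then Bernstein (i - 1) (j - 1) t else bspline p (level p i) j t))"

definition hier_basis :: "nat \<Rightarrow> nat \<Rightarrow> nat \<Rightarrow> nat \<Rightarrow> real \<times> real \<Rightarrow> real" where
  "hier_basis p n i j = bhat p n i j \<circ> sing_map_inv"

definition support_extension :: "nat \<Rightarrow> nat \<Rightarrow> (real \<times> real) set \<Rightarrow> (real \<times> real) set" where
  "support_extension p n \<delta> = interior
     (\<Union>(i, j)\<in>{(i, j) \<in> hier_index p n. \<exists>x\<in>\<delta>. hier_basis p n i j x \<noteq> 0}.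
        supp_in (Delta 1) (hier_basis p n i j))"


section \<open>Dual functionals and projection\<close>

text \<open>\<open>\<lambda> n k\<close> is the \<open>k\<close>-th functional of level \<open>n\<close>; the constant \<open>C\<close> is the same for all
  \<open>n\<close> and \<open>k\<close>.\<close>

definition bspline_dual_basis ::
    "nat \<Rightarrow> real \<Rightarrow> (nat \<Rightarrow> nat \<Rightarrow> (real \<Rightarrow> real) \<Rightarrow> real) \<Rightarrow> bool" where
  "bspline_dual_basis p C lam \<longleftrightarrow>
     (\<forall>n. \<forall>k\<in>{1..2 ^ n + p}.
        linear_on_L2 {0<..<1} (lam n k) \<and>
        (\<forall>i\<in>{1..2 ^ n + p}. lam n k (bspline p n i) = (if i = k then 1 else 0)) \<and>
        (\<forall>f\<in>L2 {0<..<1}. \<bar>lam n k f\<bar> \<le>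
           C * measure lebesgue (supp_in {0<..<1} (bspline p n k)) powr (- 1 / 2) *
           L2_norm (supp_in {0<..<1} (bspline p n k)) f))"

definition start_level :: "nat \<Rightarrow> nat" where
  "start_level p = nat \<lceil>log 2 (8 * real p)\<rceil>"

definition tip_dual_basis ::
    "nat \<Rightarrow> (nat \<Rightarrow> nat \<Rightarrow> (real \<times> real \<Rightarrow> real) \<Rightarrow> real) \<Rightarrow> bool" where
  "tip_dual_basis p mu \<longleftrightarrow>
     (\<forall>k\<in>{1..p + 1}. \<forall>l\<in>{1..k}.
        linear_on_L2 (Delta (1 / 2 ^ start_level p)) (mu k l) \<and>
        (\<exists>K. \<forall>f\<in>L2 (Delta (1 / 2 ^ start_level p)).
           \<bar>mu k l f\<bar> \<le> K * L2_norm (Delta (1 / 2 ^ start_level p)) f) \<and>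
        (\<forall>(i, j)\<in>hier_index p (start_level p).
           mu k l (hier_basis p (start_level p) i j) = (if i = k \<and> j = l then 1 else 0)))"

text \<open>The tensor product of a functional \<open>F\<close> on functions supported in \<open>I\<close> (acting in the first
  variable) and \<open>G\<close> on functions supported in \<open>J\<close> (acting in the second). The argument is
  extended by zero outside \<open>I \<times> J\<close>: the functions \<open>\<phi> \<circ> sing_map\<close> to which it is applied are
  square-integrable on \<open>I \<times> J\<close>, but in general not near \<open>s = 0\<close>. The inner function of \<open>s\<close> is
  meaningful for almost every \<open>s\<close>, by Fubini.\<close>

definition tensor_functional ::
    "real set \<Rightarrow> real set \<Rightarrow> ((real \<Rightarrow> real) \<Rightarrow> real) \<Rightarrow> ((real \<Rightarrow> real) \<Rightarrow> real) \<Rightarrow>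
     (real \<times> real \<Rightarrow> real) \<Rightarrow> real" where
  "tensor_functional I J F G f =
     F (\<lambda>s. G (\<lambda>t. if s \<in> I \<and> t \<in> J then f (s, t) else 0))"

definition hier_functional ::
    "nat \<Rightarrow> (nat \<Rightarrow> nat \<Rightarrow> (real \<Rightarrow> real) \<Rightarrow> real) \<Rightarrow>
     (nat \<Rightarrow> nat \<Rightarrow> (real \<times> real \<Rightarrow> real) \<Rightarrow> real) \<Rightarrow>
     nat \<Rightarrow> nat \<Rightarrow> nat \<Rightarrow> (real \<times> real \<Rightarrow> real) \<Rightarrow> real" where
  "hier_functional p lam mu n k l \<phi> =
     (if k \<le> p + 1
      then mu k l (\<phi> \<circ> scale_map (2 powi (int (start_level p) - int n)))
      else tensor_functional
             (supp_in {0<..<1} (bspline p n k)) (supp_in {0<..<1} (bspline p (level p k) l))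
             (lam n k) (lam (level p k) l) (\<phi> \<circ> sing_map))"

definition hier_projection ::
    "nat \<Rightarrow> (nat \<Rightarrow> nat \<Rightarrow> (real \<Rightarrow> real) \<Rightarrow> real) \<Rightarrow>
     (nat \<Rightarrow> nat \<Rightarrow> (real \<times> real \<Rightarrow> real) \<Rightarrow> real) \<Rightarrow>
     nat \<Rightarrow> (real \<times> real \<Rightarrow> real) \<Rightarrow> real \<times> real \<Rightarrow> real" where
  "hier_projection p lam mu n \<phi> =
     (\<lambda>x. \<Sum>(k, l)\<in>hier_index p n. hier_functional p lam mu n k l \<phi> * hier_basis p n k l x)"

end

theory Submission
  imports Defs
begin

text \<open>Every basis function is at most \<open>4 ^ p\<close> in absolute value, every cell of level \<open>n\<close> has area at
  most \<open>4 ^ -n\<close>, and at most \<open>(p + 1)\<^sup>2\<close> basis functions are active on a cell. It therefore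
  suffices to bound each functional belonging to an active basis function by a multiple of
  \<open>2 ^ n\<close> times the norm of \<open>\<phi>\<close> on the support of that function. Near the tip this is scaling.
  Otherwise, a tensor product functional of level \<open>m\<close> in \<open>t\<close> has the squared norm
  \<open>O(2 ^ n * 2 ^ m)\<close> with respect to \<open>(s, t)\<close>, while the Jacobian \<open>s\<close> of the singular map is at
  least \<open>2 ^ (m - 1) / 2 ^ n\<close> there, so the dependence on \<open>m\<close> cancels.\<close>

text \<open>Two mismatches shape the proof. The dual functionals are bounded on closed supports,
  whereas \<open>support_extension\<close> is an interior. The bounds are therefore moved to open
  knot intervals, which differ from the supports by null sets. B-splines are positive there, so the
  corresponding open part of the triangle survives the interior. Near the tip, Bernstein polynomials
  are positive on all of ]0,1[, so the whole small triangle seen by the rescaled functional lies in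
  the support of its own basis function.

  Secondly, the functionals are abstract and their tensor product is an iterated application: the
  inner result must be shown to be measurable and square-integrable in s before the outer bound says
  anything. As \<open>\<phi>\<close> is only Lebesgue measurable, this goes through a Borel
  representative.

  The count of active functions rests on the grading of the mesh: a cell with slope resolution 2^-m
  carries only functions of level at most m in t, and so lies within one knot interval of each of
  these levels.\<close>

section \<open>B-splines\<close>

text \<open>The half-open condition is inherited from degree 0. Outside the support the quotients of
  the recursion may leave [0, 1]; the sign and size bounds below use this lemma to discard that
  case.\<close>

lemma cox_de_boor_eq_0:
  assumes "mono \<xi>" "s < \<xi> i \<or> \<xi> (i + d + 1) \<le> s"
  shows "cox_de_boor \<xi> d i s = 0"
  using assms(2)
proof (induction d arbitrary: i)
  case (Suc d)
  have "\<xi> i \<le> \<xi> (i + 1)" "\<xi> (i + d + 1) \<le> \<xi> (i + d + 2)"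
    using assms(1) by (auto simp: mono_def)
  then show ?case
    using Suc.IH[of i] Suc.IH[of "i + 1"] Suc.prems by fastforce
qed auto

lemma cox_de_boor_nonneg:
  assumes "mono \<xi>"
  shows "0 \<le> cox_de_boor \<xi> d i s"
proof (induction d arbitrary: i)
  case (Suc d)
  have "0 \<le> (s - \<xi> i) / (\<xi> (i + d + 1) - \<xi> i) * cox_de_boor \<xi> d i s"
  proof (cases "s < \<xi> i \<or> \<xi> (i + d + 1) \<le> s")
    case False
    then show ?thesis using Suc[of i] by simp
  qed (simp add: cox_de_boor_eq_0[OF assms])
  moreover have "0 \<le> (\<xi> (i + d + 2) - s) / (\<xi> (i + d + 2) - \<xi> (i + 1)) * cox_de_boor \<xi> d (i + 1) s"
  proof (cases "s < \<xi> (i + 1) \<or> \<xi> (i + d + 2) \<le> s")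
    case False
    then show ?thesis using Suc[of "i + 1"] by simp
  next
    case True
    then show ?thesis using cox_de_boor_eq_0[OF assms, of s "i + 1" d] by auto
  qed
  ultimately show ?case by simp
qed simp

text \<open>Both quotients are at most 1 wherever the factor next to them is nonzero, so each degree
  at most doubles the bound. A constant depending only on the degree suffices, which spares the
  partition of unity.\<close>

lemma cox_de_boor_le:
  assumes "mono \<xi>"
  shows "cox_de_boor \<xi> d i s \<le> 2 ^ d"
proof (induction d arbitrary: i)
  case (Suc d)
  have "(s - \<xi> i) / (\<xi> (i + d + 1) - \<xi> i) * cox_de_boor \<xi> d i s \<le> 2 ^ d"
  proof (cases "s < \<xi> i \<or> \<xi> (i + d + 1) \<le> s")
    case False
    then have "(s - \<xi> i) / (\<xi> (i + d + 1) - \<xi> i) * cox_de_boor \<xi> d i s \<le> 1 * 2 ^ d"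
      using Suc[of i] by (intro mult_mono cox_de_boor_nonneg assms) auto
    then show ?thesis by simp
  qed (simp add: cox_de_boor_eq_0[OF assms])
  moreover have "(\<xi> (i + d + 2) - s) / (\<xi> (i + d + 2) - \<xi> (i + 1)) * cox_de_boor \<xi> d (i + 1) s \<le> 2 ^ d"
  proof (cases "s < \<xi> (i + 1) \<or> \<xi> (i + d + 2) \<le> s")
    case False
    then have "(\<xi> (i + d + 2) - s) / (\<xi> (i + d + 2) - \<xi> (i + 1)) * cox_de_boor \<xi> d (i + 1) s \<le> 1 * 2 ^ d"
      using Suc[of "i + 1"] by (intro mult_mono cox_de_boor_nonneg assms) auto
    then show ?thesis by simp
  next
    case True
    then show ?thesis using cox_de_boor_eq_0[OF assms, of s "i + 1" d] by auto
  qed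
  ultimately show ?case by simp
qed simp

text \<open>The last assumption admits \<open>s = \<xi> i\<close> when that knot is repeated up to \<open>\<xi> (i + d)\<close>, which the
  induction meets when it moves to the index \<open>i + 1\<close> at a knot.\<close>

lemma cox_de_boor_pos_strong:
  assumes "mono \<xi>" "\<xi> i \<le> s" "s < \<xi> (i + d + 1)" "\<xi> i < s \<or> \<xi> (i + d) \<le> s"
  shows "0 < cox_de_boor \<xi> d i s"
  using assms(2-4)
proof (induction d arbitrary: i)
  case (Suc d)
  define P where "P = (s - \<xi> i) / (\<xi> (i + d + 1) - \<xi> i) * cox_de_boor \<xi> d i s"
  define Q where "Q = (\<xi> (i + d + 2) - s) / (\<xi> (i + d + 2) - \<xi> (i + 1)) * cox_de_boor \<xi> d (i + 1) s"
  have PQ: "cox_de_boor \<xi> (Suc d) i s = P + Q"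
    unfolding P_def Q_def by (rule cox_de_boor.simps)
  have s2: "s < \<xi> (i + d + 2)" using Suc.prems(2) by simp
  show ?case
  proof (cases "s < \<xi> (i + d + 1)")
    case True
    then have "\<xi> i < s" using Suc.prems(3) by simp
    then have "0 < P"
      using Suc.IH[of i] True by (simp add: P_def)
    moreover have "0 \<le> Q"
    proof (cases "s < \<xi> (i + 1)")
      case True
      then show ?thesis using cox_de_boor_eq_0[OF assms(1), of s "i + 1" d] by (simp add: Q_def)
    next
      case False
      then show ?thesis
        using s2 cox_de_boor_nonneg[OF assms(1), of d "i + 1" s] by (simp add: Q_def)
    qed
    ultimately show ?thesis unfolding PQ by linarith
  next
    case False
    then have "P = 0" by (simp add: P_def cox_de_boor_eq_0[OF assms(1)])
    have "\<xi> (i + 1) \<le> \<xi> (i + d + 1)" using assms(1) by (auto simp: mono_def)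
    then have "\<xi> (i + 1) \<le> s" using False by simp
    then have "0 < Q"
      using Suc.IH[of "i + 1"] False s2 by (simp add: Q_def)
    then show ?thesis unfolding PQ \<open>P = 0\<close> by simp
  qed
qed auto

lemma cox_de_boor_pos:
  assumes "mono \<xi>" "\<xi> i < s" "s < \<xi> (i + d + 1)"
  shows "0 < cox_de_boor \<xi> d i s"
  using assms cox_de_boor_pos_strong[of \<xi> i s d] by simp

lemma borel_measurable_cox_de_boor [measurable]: "cox_de_boor \<xi> d i \<in> borel_measurable borel"
proof (induction d arbitrary: i)
  case (Suc d)
  note [measurable] = Suc
  show ?case by simp
next
  case 0
  have "cox_de_boor \<xi> 0 i = indicator {\<xi> i..<\<xi> (i + 1)}"
    by (auto simp: fun_eq_iff indicator_def)
  then show ?case by simp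
qed

section \<open>The open knot vector\<close>

lemma mono_open_knot: "mono (open_knot p n)"
proof (rule monoI)
  fix i j :: nat assume "i \<le> j"
  moreover have "real (i - p - 1) \<le> 2 ^ n" if "i \<le> p + 2 ^ n"
  proof -
    have "real (i - p - 1) \<le> real (2 ^ n)" using that by (subst of_nat_le_iff) simp
    then show ?thesis by simp
  qed
  ultimately show "open_knot p n i \<le> open_knot p n j"
    by (auto simp: open_knot_def divide_right_mono diff_le_mono simp del: of_nat_diff)
qed

lemma open_knot_nonneg: "0 \<le> open_knot p n i"
  by (simp add: open_knot_def)

lemma open_knot_le_1: "open_knot p n i \<le> 1"
  using monoD[OF mono_open_knot, of i "i + (p + 2 ^ n + 2)" p n] by (simp add: open_knot_def)

text \<open>Knots are the values (i - p - 1) / 2^n clamped to [0, 1]. Clamping at 0 only raises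
  them, so this inequality fails only beyond the first knot equal to 1; clamping at 1 only lowers
  them, which gives the converse inequality from \<open>p + 1\<close> on.\<close>

lemma open_knot_lower:
  assumes "i \<le> p + 2 ^ n + 1"
  shows "real i - real p - 1 \<le> open_knot p n i * 2 ^ n"
proof -
  consider "i \<le> p + 1" | "p + 1 < i" "i \<le> p + 2 ^ n" | "i = p + 1 + 2 ^ n" using assms by linarith
  then show ?thesis by cases (auto simp: open_knot_def)
qed

lemma open_knot_upper: "p + 1 \<le> i \<Longrightarrow> open_knot p n i * 2 ^ n \<le> real i - real p - 1"
proof -
  assume "p + 1 \<le> i"
  moreover have "2 ^ n \<le> real i - real p - 1" if "p + 2 ^ n < i"
  proof -
    have "real (2 ^ n + p + 1) \<le> real i" using that by (subst of_nat_le_iff) simp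
    then show ?thesis by simp
  qed
  ultimately show ?thesis by (auto simp: open_knot_def)
qed

text \<open>Beyond \<open>p + 1\<close> the step from \<open>k\<close> to \<open>k + 1\<close>
  already gains a mesh width; for smaller \<open>k\<close> the knot is 0 and the index
  \<open>k + p + 1\<close> is past all repetitions of 0. This keeps the factor |I|^(-1/2) of the
  dual functionals below 2^(n/2).\<close>

lemma open_knot_span:
  assumes "1 \<le> k" "k \<le> 2 ^ n + p"
  shows "open_knot p n k + 1 / 2 ^ n \<le> open_knot p n (k + p + 1)"
proof -
  have "open_knot p n k * 2 ^ n + 1 \<le> open_knot p n (k + p + 1) * 2 ^ n"
  proof (cases "k \<le> p + 1")
    case True
    have "1 \<le> open_knot p n (p + 2) * 2 ^ n"
      using open_knot_lower[of "p + 2" p n] by simp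
    also have "\<dots> \<le> open_knot p n (k + p + 1) * 2 ^ n"
      using assms by (intro mult_right_mono monoD[OF mono_open_knot]) auto
    finally show ?thesis using True by (simp add: open_knot_def)
  next
    case False
    have "open_knot p n k * 2 ^ n + 1 \<le> real (k + 1) - p - 1"
      using open_knot_upper[of p k n] False by simp
    also have "\<dots> \<le> open_knot p n (k + 1) * 2 ^ n"
      using assms by (intro open_knot_lower) simp
    also have "\<dots> \<le> open_knot p n (k + p + 1) * 2 ^ n"
      by (intro mult_right_mono monoD[OF mono_open_knot]) auto
    finally show ?thesis .
  qed
  then have "(open_knot p n k * 2 ^ n + 1) / 2 ^ n \<le> open_knot p n (k + p + 1) * 2 ^ n / 2 ^ n"
    by (rule divide_right_mono) simp
  then show ?thesis by (simp add: add_divide_distrib)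
qed

section \<open>B-splines and their supports\<close>

lemma bspline_nonneg: "0 \<le> bspline p n k s"
  by (simp add: bspline_def cox_de_boor_nonneg mono_open_knot)

lemma bspline_le: "bspline p n k s \<le> 2 ^ p"
  by (simp add: bspline_def cox_de_boor_le mono_open_knot)

lemma bspline_pos: "open_knot p n k < s \<Longrightarrow> s < open_knot p n (k + p + 1) \<Longrightarrow> 0 < bspline p n k s"
  by (simp add: bspline_def cox_de_boor_pos mono_open_knot)

lemma bspline_nonzeroD:
  "bspline p n k s \<noteq> 0 \<Longrightarrow> open_knot p n k \<le> s \<and> s < open_knot p n (k + p + 1)"
  using cox_de_boor_eq_0[OF mono_open_knot, of s p n k p] by (force simp: bspline_def)

lemma borel_measurable_bspline [measurable]: "bspline p n k \<in> borel_measurable borel"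
  by (simp add: bspline_def borel_measurable_cox_de_boor)

text \<open>A support spans at most \<open>p + 1\<close> mesh intervals; this is the source of the
  factor \<open>p + 1\<close> in each direction. Scaling by \<open>2 ^ n\<close> turns the overlap
  into inequalities between integers.\<close>

lemma bspline_active:
  assumes "bspline p n k s \<noteq> 0" "1 \<le> a" "k \<le> 2 ^ n + p"
    and "(real a - 1) / 2 ^ n < s" "s < real a / 2 ^ n"
  shows "a \<le> k" "k \<le> a + p"
proof -
  have s: "open_knot p n k * 2 ^ n \<le> s * 2 ^ n" "s * 2 ^ n < open_knot p n (k + p + 1) * 2 ^ n"
    using bspline_nonzeroD[OF assms(1)] by simp_all
  have a: "real a - 1 < s * 2 ^ n" "s * 2 ^ n < real a"
    using assms by (simp_all add: field_simps)
  have "real k - real p - 1 < real a" using open_knot_lower[of k p n] assms(3) s a by linarith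
  then show "k \<le> a + p" by linarith
  have "open_knot p n (k + p + 1) * 2 ^ n \<le> real k"
    using open_knot_upper[of p "k + p + 1" n] by simp
  then have "real a - 1 < real k" using s(2) a(1) by linarith
  then show "a \<le> k" by linarith
qed

text \<open>The support without its end points. Being open, products of such intervals are mapped by
  \<open>sing_map\<close> into the interior that \<open>support_extension\<close> takes.\<close>

definition knot_supp :: "nat \<Rightarrow> nat \<Rightarrow> nat \<Rightarrow> real set" where
  "knot_supp p n k = {open_knot p n k <..< open_knot p n (k + p + 1)}"

lemma supp_in_bspline_subset:
  "supp_in {0<..<1} (bspline p n k) \<subseteq> {0<..<1} \<inter> {open_knot p n k .. open_knot p n (k + p + 1)}"
proof -
  have "closure {s \<in> {0<..<1}. bspline p n k s \<noteq> 0} \<subseteq> {open_knot p n k .. open_knot p n (k + p + 1)}"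
    by (rule closure_minimal) (auto dest: bspline_nonzeroD)
  then show ?thesis by (auto simp: supp_in_def)
qed

lemma knot_supp_subset: "knot_supp p n k \<subseteq> {0<..<1}"
proof
  fix s assume "s \<in> knot_supp p n k"
  then show "s \<in> {0<..<1}"
    using open_knot_nonneg[of p n k] open_knot_le_1[of p n "k + p + 1"]
    by (simp add: knot_supp_def) 
qed

lemma knot_supp_subset_supp_in: "knot_supp p n k \<subseteq> supp_in {0<..<1} (bspline p n k)"
proof
  fix s assume *: "s \<in> knot_supp p n k"
  then have "s \<in> {0<..<1}" using knot_supp_subset by blast
  moreover have "bspline p n k s \<noteq> 0" using * bspline_pos[of p n k s] by (simp add: knot_supp_def)
  ultimately show "s \<in> supp_in {0<..<1} (bspline p n k)"
    by (auto simp: supp_in_def intro!: closure_subset[THEN subsetD])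
qed

lemma supp_in_borel: "S \<in> sets borel \<Longrightarrow> supp_in S f \<in> sets borel"
  by (simp add: supp_in_def borel_closed sets.Int)

text \<open>The closure in \<open>supp_in\<close> can add only the two end points, and integrals do
  not see them.\<close>

lemma AE_supp_in_bspline:
  "AE s in lborel. s \<in> supp_in {0<..<1} (bspline p n k) \<longleftrightarrow> s \<in> knot_supp p n k"
proof -
  have "AE s in lborel. s \<noteq> open_knot p n k" "AE s in lborel. s \<noteq> open_knot p n (k + p + 1)"
    by (rule AE_lborel_singleton)+
  then show ?thesis
  proof eventually_elim
    case (elim s)
    then show ?case
      using supp_in_bspline_subset[of p n k] knot_supp_subset_supp_in[of p n k]
      by (force simp: knot_supp_def)
  qed
qed

lemma measure_supp_in_bspline:
  assumes "1 \<le> k" "k \<le> 2 ^ n + p"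
  shows "1 / 2 ^ n \<le> measure lebesgue (supp_in {0<..<1} (bspline p n k))"
proof -
  have "1 / 2 ^ n \<le> measure lebesgue (knot_supp p n k)"
  proof -
    have "open_knot p n k \<le> open_knot p n (k + p + 1)"
      using monoD[OF mono_open_knot] by simp
    then show ?thesis
      using open_knot_span[OF assms] by (simp add: knot_supp_def measure_completion)
  qed
  also have "\<dots> \<le> measure lebesgue (supp_in {0<..<1} (bspline p n k))"
  proof (rule measure_mono_fmeasurable)
    have "supp_in {0<..<1} (bspline p n k) \<in> sets lebesgue"
      using supp_in_borel[of "{0<..<1}" "bspline p n k"] by simp
    then show "supp_in {0<..<1} (bspline p n k) \<in> lmeasurable"
      by (rule bounded_set_imp_lmeasurable[rotated])
         (rule bounded_subset[OF bounded_closed_interval[of 0 1]], auto simp: supp_in_def)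
  qed (use knot_supp_subset_supp_in in \<open>auto simp: knot_supp_def\<close>)
  finally show ?thesis .
qed

section \<open>Square-integrable functions and bounded functionals\<close>

text \<open>The squared norm with values in \<open>ennreal\<close>: monotonicity and Tonelli hold
  without integrability conditions, and infinity is not confused with 0 as it is by
  \<open>L2_norm\<close> outside \<open>L2\<close>.\<close>

definition sqint :: "'a::euclidean_space set \<Rightarrow> ('a \<Rightarrow> real) \<Rightarrow> ennreal" where
  "sqint S f = (\<integral>\<^sup>+x. ennreal ((f x)\<^sup>2) \<partial>lebesgue_on S)"

lemma sqint_eq:
  "S \<in> sets lebesgue \<Longrightarrow> sqint S f = (\<integral>\<^sup>+x. ennreal ((f x)\<^sup>2) * indicator S x \<partial>lborel)"
  by (simp add: sqint_def nn_integral_restrict_space nn_integral_completion)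

lemma L2_I:
  assumes "f \<in> borel_measurable (lebesgue_on S)" "sqint S f < \<infinity>"
  shows "f \<in> L2 S"
proof -
  note [measurable] = assms(1)
  have "integrable (lebesgue_on S) (\<lambda>x. (f x)\<^sup>2)"
    by (rule integrableI_nonneg) (use assms(2) in \<open>simp_all add: sqint_def\<close>)
  then show ?thesis using assms(1) by (simp add: L2_def)
qed

lemma sqint_L2: "f \<in> L2 S \<Longrightarrow> sqint S f = ennreal ((L2_norm S f)\<^sup>2)"
  by (simp add: L2_def L2_norm_def sqint_def nn_integral_eq_integral)

lemma sqint_finite: "f \<in> L2 S \<Longrightarrow> sqint S f < \<infinity>"
  by (simp add: sqint_L2)

lemma L2_norm_nonneg: "0 \<le> L2_norm S f"
  by (simp add: L2_norm_def)

lemma L2_measurable: "f \<in> L2 S \<Longrightarrow> f \<in> borel_measurable (lebesgue_on S)"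
  by (simp add: L2_def)

lemma sqint_mono_set:
  assumes "S \<in> sets lebesgue" "T \<in> sets lebesgue" "S \<subseteq> T"
  shows "sqint S f \<le> sqint T f"
  unfolding sqint_eq[OF assms(1)] sqint_eq[OF assms(2)]
  by (rule nn_integral_mono) (use assms(3) in \<open>auto simp: indicator_def\<close>)

lemma L2_subset:
  assumes "f \<in> L2 T" "S \<in> sets lebesgue" "T \<in> sets lebesgue" "S \<subseteq> T"
  shows "f \<in> L2 S"
proof (rule L2_I)
  show "f \<in> borel_measurable (lebesgue_on S)"
    using L2_measurable[OF assms(1)] assms(4) by (rule measurable_restrict_mono)
  show "sqint S f < \<infinity>"
    using sqint_mono_set[OF assms(2-4), of f] sqint_finite[OF assms(1)] by (rule le_less_trans)
qed

lemma L2_norm_le_sqint: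
  assumes "ennreal (x\<^sup>2) \<le> ennreal (c\<^sup>2) * sqint S f" "f \<in> L2 S" "0 \<le> c"
  shows "\<bar>x\<bar> \<le> c * L2_norm S f"
proof -
  have "ennreal (x\<^sup>2) \<le> ennreal (c\<^sup>2 * (L2_norm S f)\<^sup>2)"
    using assms by (simp add: sqint_L2 ennreal_mult)
  then have "x\<^sup>2 \<le> (c * L2_norm S f)\<^sup>2"
    by (simp add: power_mult_distrib)
  then show ?thesis
    using assms(3) by (simp add: abs_le_square_iff[symmetric] abs_mult L2_norm_nonneg)
qed

lemma L2_norm_mono_set:
  assumes "f \<in> L2 T" "S \<in> sets lebesgue" "T \<in> sets lebesgue" "S \<subseteq> T"
  shows "L2_norm S f \<le> L2_norm T f"
proof -
  have "\<bar>L2_norm S f\<bar> \<le> 1 * L2_norm T f"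
    using sqint_mono_set[OF assms(2-4), of f]
    by (intro L2_norm_le_sqint assms(1)) (simp_all add: sqint_L2[OF L2_subset[OF assms]])
  then show ?thesis by simp
qed

lemma L2_lincomb:
  assumes "f \<in> L2 S" "g \<in> L2 S"
  shows "(\<lambda>x. a * f x + b * g x) \<in> L2 S"
proof -
  note [measurable] = L2_measurable[OF assms(1)] L2_measurable[OF assms(2)]
  have "integrable (lebesgue_on S) (\<lambda>x. 2 * a\<^sup>2 * (f x)\<^sup>2 + 2 * b\<^sup>2 * (g x)\<^sup>2)"
    using assms by (simp add: L2_def)
  then have "integrable (lebesgue_on S) (\<lambda>x. (a * f x + b * g x)\<^sup>2)"
  proof (rule Bochner_Integration.integrable_bound)
    show "AE x in lebesgue_on S. norm ((a * f x + b * g x)\<^sup>2) \<le> norm (2 * a\<^sup>2 * (f x)\<^sup>2 + 2 * b\<^sup>2 * (g x)\<^sup>2)"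
    proof (rule AE_I2)
      fix x
      have "(a * f x + b * g x)\<^sup>2 \<le> 2 * (a * f x)\<^sup>2 + 2 * (b * g x)\<^sup>2"
        using zero_le_power2[of "a * f x - b * g x"] by (simp add: power2_eq_square algebra_simps)
      then show "norm ((a * f x + b * g x)\<^sup>2) \<le> norm (2 * a\<^sup>2 * (f x)\<^sup>2 + 2 * b\<^sup>2 * (g x)\<^sup>2)"
        by (simp add: power_mult_distrib)
    qed
  qed measurable
  then show ?thesis by (simp add: L2_def)
qed

lemma L2_zero: "(\<lambda>x. 0) \<in> L2 S"
  by (simp add: L2_def)

lemma L2_sum: "(\<And>i. i \<in> A \<Longrightarrow> f i \<in> L2 S) \<Longrightarrow> (\<lambda>x. \<Sum>i\<in>A. c i * f i x) \<in> L2 S"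
proof (induction A rule: infinite_finite_induct)
  case (insert i A)
  then have "(\<lambda>x. c i * f i x + 1 * (\<Sum>i\<in>A. c i * f i x)) \<in> L2 S"
    by (intro L2_lincomb) auto
  then show ?case using insert by simp
qed (simp_all add: L2_zero)

section \<open>Linear functionals on square-integrable functions\<close>

lemma linear_on_L2D:
  "linear_on_L2 S G \<Longrightarrow> f \<in> L2 S \<Longrightarrow> g \<in> L2 S \<Longrightarrow>
    G (\<lambda>x. a * f x + b * g x) = a * G f + b * G g"
  by (simp add: linear_on_L2_def)

lemma linear_on_L2_cmult:
  assumes "linear_on_L2 S G" "f \<in> L2 S"
  shows "G (\<lambda>x. c * f x) = c * G f"
proof -
  have "G (\<lambda>x. c * f x + 0 * f x) = c * G f + 0 * G f"
    using assms by (intro linear_on_L2D)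
  then show ?thesis by simp
qed

lemma linear_on_L2_zero: "linear_on_L2 S G \<Longrightarrow> G (\<lambda>x. 0) = 0"
  using linear_on_L2_cmult[OF _ L2_zero, of S G 0] by simp

lemma linear_on_L2_sum:
  assumes "linear_on_L2 S G" "\<And>i. i \<in> A \<Longrightarrow> f i \<in> L2 S"
  shows "G (\<lambda>x. \<Sum>i\<in>A. c i * f i x) = (\<Sum>i\<in>A. c i * G (f i))"
  using assms(2)
proof (induction A rule: infinite_finite_induct)
  case (insert i A)
  have "G (\<lambda>x. c i * f i x + 1 * (\<Sum>i\<in>A. c i * f i x)) = c i * G (f i) + 1 * G (\<lambda>x. \<Sum>i\<in>A. c i * f i x)"
    by (rule linear_on_L2D[OF assms(1)]) (use insert.prems L2_sum[of A f S c] in auto)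
  then show ?case using insert by simp
qed (simp_all add: linear_on_L2_zero[OF assms(1)])

text \<open>\<open>B\<close> bounds the square of the norm, and only the values on \<open>J\<close> matter.\<close>

definition L2_functional :: "'a::euclidean_space set \<Rightarrow> real \<Rightarrow> 'a set \<Rightarrow> (('a \<Rightarrow> real) \<Rightarrow> real) \<Rightarrow> bool" where
  "L2_functional S B J G \<longleftrightarrow> linear_on_L2 S G \<and> J \<in> sets borel \<and> J \<subseteq> S \<and> 0 \<le> B \<and>
     (\<forall>f\<in>L2 S. ennreal ((G f)\<^sup>2) \<le> ennreal B * sqint J f)"

text \<open>The bound is applied to the difference, whose squared integral is 0. Functionals here
  act on functions rather than on classes, so this invariance has to be derived.\<close>

lemma L2_functional_cong_AE:
  assumes G: "L2_functional S B J G" and fg: "f \<in> L2 S" "g \<in> L2 S" and ae: "AE x in lborel. f x = g x"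
  shows "G f = G g"
proof -
  have d: "(\<lambda>x. 1 * f x + - 1 * g x) \<in> L2 S" by (rule L2_lincomb) (rule fg)+
  have J: "J \<in> sets lebesgue" using G by (auto simp: L2_functional_def)
  have "sqint J (\<lambda>x. 1 * f x + - 1 * g x) = 0"
    unfolding sqint_eq[OF J]
    by (subst nn_integral_cong_AE[where v = "\<lambda>x. 0"]) (use ae in auto)
  then have "ennreal ((G (\<lambda>x. 1 * f x + - 1 * g x))\<^sup>2) \<le> 0"
    using G d by (auto simp: L2_functional_def dest!: bspec[OF _ d])
  moreover have "G (\<lambda>x. 1 * f x + - 1 * g x) = 1 * G f + - 1 * G g"
    using G fg by (intro linear_on_L2D) (auto simp: L2_functional_def)
  ultimately show ?thesis by simp
qed

text \<open>Since |f i - g| is at most 2 w, dominated convergence with the majorant 4 w^2 gives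
  convergence in the L2 norm, and the bound of \<open>G\<close> turns it into convergence of the
  values.\<close>

lemma L2_functional_tendsto:
  assumes G: "L2_functional S B J G" and S: "S \<in> sets lebesgue"
    and w: "w \<in> L2 S"
    and f: "\<And>i. f i \<in> borel_measurable (lebesgue_on S)" "\<And>i x. \<bar>f i x\<bar> \<le> w x"
    and lim: "\<And>x. (\<lambda>i. f i x) \<longlonglongrightarrow> g x"
  shows "(\<lambda>i. G (f i)) \<longlonglongrightarrow> G g"
proof -
  have g: "\<bar>g x\<bar> \<le> w x" for x
    by (rule LIMSEQ_le_const2[OF tendsto_rabs[OF lim]]) (use f(2) in auto)
  have gm: "g \<in> borel_measurable (lebesgue_on S)"
    by (rule borel_measurable_LIMSEQ_real[OF _ f(1)]) (rule lim)
  have L2: "h \<in> L2 S" if "h \<in> borel_measurable (lebesgue_on S)" "\<And>x. \<bar>h x\<bar> \<le> w x" for h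
  proof (rule L2_I)
    have "sqint S h \<le> sqint S w"
      unfolding sqint_def using that(2)
      by (intro nn_integral_mono ennreal_leI) (metis abs_le_square_iff abs_of_nonneg abs_ge_zero order_trans)
    also have "\<dots> < \<infinity>" using w by (rule sqint_finite)
    finally show "sqint S h < \<infinity>" .
  qed fact
  have fL: "f i \<in> L2 S" and gL: "g \<in> L2 S" for i using L2 f gm g by auto
  note [measurable] = f(1) gm L2_measurable[OF w]
  have J: "J \<in> sets lebesgue" "J \<subseteq> S" and B: "0 \<le> B" using G by (auto simp: L2_functional_def)
  have d: "(\<lambda>x. 1 * f i x + - 1 * g x) \<in> L2 S" for i by (rule L2_lincomb) (rule fL gL)+
  have lim0: "(\<lambda>i. sqint S (\<lambda>x. 1 * f i x + - 1 * g x)) \<longlonglongrightarrow> (\<integral>\<^sup>+x. 0 \<partial>lebesgue_on S)"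
    unfolding sqint_def
  proof (rule nn_integral_dominated_convergence[where w = "\<lambda>x. ennreal (4 * (w x)\<^sup>2)"])
    have "(\<integral>\<^sup>+ x. ennreal (4 * (w x)\<^sup>2) \<partial>lebesgue_on S) = 4 * sqint S w"
      by (simp add: sqint_def nn_integral_cmult[symmetric] ennreal_mult)
    also have "\<dots> < \<infinity>" using sqint_finite[OF w] by (simp add: ennreal_mult_less_top)
    finally show "(\<integral>\<^sup>+ x. ennreal (4 * (w x)\<^sup>2) \<partial>lebesgue_on S) < \<infinity>" .
    show "AE x in lebesgue_on S. ennreal ((1 * f i x + - 1 * g x)\<^sup>2) \<le> ennreal (4 * (w x)\<^sup>2)" for i
    proof (intro AE_I2 ennreal_leI)
      fix x
      have "\<bar>f i x - g x\<bar> \<le> \<bar>2 * w x\<bar>" using f(2)[of i x] g[of x] by linarith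
      then have "(f i x - g x)\<^sup>2 \<le> (2 * w x)\<^sup>2" by (simp only: abs_le_square_iff)
      then show "(1 * f i x + - 1 * g x)\<^sup>2 \<le> 4 * (w x)\<^sup>2" by (simp add: power_mult_distrib)
    qed
    show "AE x in lebesgue_on S. (\<lambda>i. ennreal ((1 * f i x + - 1 * g x)\<^sup>2)) \<longlonglongrightarrow> 0"
    proof (rule AE_I2)
      fix x
      have "(\<lambda>i. ennreal ((1 * f i x + - 1 * g x)\<^sup>2)) \<longlonglongrightarrow> ennreal ((1 * g x + - 1 * g x)\<^sup>2)"
        by (intro tendsto_intros lim)
      then show "(\<lambda>i. ennreal ((1 * f i x + - 1 * g x)\<^sup>2)) \<longlonglongrightarrow> 0"
        by simp
    qed
  qed auto
  have l: "(\<lambda>i. ennreal B * sqint S (\<lambda>x. 1 * f i x + - 1 * g x)) \<longlonglongrightarrow> ennreal B * 0"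
    using lim0 by (intro tendsto_mult_ennreal tendsto_const) auto
  have u: "ennreal ((G (f i) - G g)\<^sup>2) \<le> ennreal B * sqint S (\<lambda>x. 1 * f i x + - 1 * g x)" for i
  proof -
    have "G (\<lambda>x. 1 * f i x + - 1 * g x) = 1 * G (f i) + - 1 * G g"
      using G fL gL by (intro linear_on_L2D) (auto simp: L2_functional_def)
    moreover have "ennreal ((G (\<lambda>x. 1 * f i x + - 1 * g x))\<^sup>2) \<le> ennreal B * sqint J (\<lambda>x. 1 * f i x + - 1 * g x)"
      using G d unfolding L2_functional_def by blast
    ultimately show ?thesis
      using sqint_mono_set[OF J(1) S J(2), of "\<lambda>x. 1 * f i x + - 1 * g x"]
      by (simp, elim order_trans) (rule mult_left_mono, simp_all)
  qed
  have "(\<lambda>i. ennreal ((G (f i) - G g)\<^sup>2)) \<longlonglongrightarrow> ennreal B * 0"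
    by (rule tendsto_sandwich[OF always_eventually always_eventually tendsto_const l])
       (use u in auto)
  then have "(\<lambda>i. (G (f i) - G g)\<^sup>2) \<longlonglongrightarrow> 0"
    using tendsto_ennrealD[of "\<lambda>i. (G (f i) - G g)\<^sup>2" 0 sequentially] by simp
  then have "(\<lambda>i. sqrt ((G (f i) - G g)\<^sup>2)) \<longlonglongrightarrow> sqrt 0"
    by (rule tendsto_real_sqrt)
  then have "(\<lambda>i. G (f i) - G g) \<longlonglongrightarrow> 0"
    by (simp add: tendsto_rabs_zero_iff)
  then show ?thesis by (rule LIM_zero_cancel)
qed

section \<open>Tensor products of functionals\<close>

lemma sqint_bounded:
  assumes "S \<in> lmeasurable" "\<And>x. x \<in> S \<Longrightarrow> \<bar>f x\<bar> \<le> c"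
  shows "sqint S f \<le> ennreal (c\<^sup>2) * emeasure lebesgue S"
proof -
  have "sqint S f \<le> (\<integral>\<^sup>+x. ennreal (c\<^sup>2) \<partial>lebesgue_on S)"
    unfolding sqint_def
  proof (intro nn_integral_mono ennreal_leI)
    fix x assume "x \<in> space (lebesgue_on S)"
    then have "\<bar>f x\<bar> \<le> c" using assms by (auto simp: space_restrict_space)
    then have "\<bar>f x\<bar> \<le> \<bar>c\<bar>" by linarith
    then show "(f x)\<^sup>2 \<le> c\<^sup>2" by (simp only: abs_le_square_iff)
  qed
  also have "\<dots> = ennreal (c\<^sup>2) * emeasure lebesgue S"
    using assms(1) by (simp add: emeasure_restrict_space space_restrict_space fmeasurable_def)
  finally show ?thesis .
qed

lemma L2_bounded:
  assumes "S \<in> lmeasurable" "f \<in> borel_measurable borel" "\<And>x. x \<in> S \<Longrightarrow> \<bar>f x\<bar> \<le> c"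
  shows "f \<in> L2 S"
proof (rule L2_I)
  show "f \<in> borel_measurable (lebesgue_on S)"
    using assms(2) by (intro measurable_restrict_space1 measurable_completion) simp
  note sqint_bounded[OF assms(1,3)]
  also have "ennreal (c\<^sup>2) * emeasure lebesgue S < \<infinity>"
    using assms(1) by (simp add: fmeasurable_def ennreal_mult_less_top del: emeasure_completion)
  finally show "sqint S f < \<infinity>" .
qed

text \<open>Completeness of \<open>lebesgue\<close> carries measurability from a Borel function to
  any function equal to it almost everywhere. The inner result of a tensor product is known only in
  this sense.\<close>

lemma L2_AE_eq:
  fixes f g :: "'a::euclidean_space \<Rightarrow> real"
  assumes "S \<in> sets lebesgue" "AE x in lborel. f x = g x" "g \<in> borel_measurable borel"
    and "sqint S g < \<infinity>"
  shows "f \<in> L2 S"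
proof (rule L2_I)
  have "g \<in> borel_measurable lebesgue"
    using assms(3) by (intro measurable_completion) simp
  then have "f \<in> borel_measurable lebesgue"
    by (rule borel_measurable_AE) (use assms(2) in \<open>auto intro!: AE_completion\<close>)
  then show "f \<in> borel_measurable (lebesgue_on S)"
    by (rule measurable_restrict_space1)
  have "sqint S f = sqint S g"
    unfolding sqint_eq[OF assms(1)] by (rule nn_integral_cong_AE) (use assms(2) in auto)
  then show "sqint S f < \<infinity>" using assms(4) by simp
qed

lemma section_borel:
  fixes g :: "real \<times> real \<Rightarrow> 'b::topological_space"
  assumes "g \<in> borel_measurable borel"
  shows "(\<lambda>t. g (s, t)) \<in> borel_measurable borel"
  by (rule measurable_compose[OF _ assms]) (auto intro!: borel_measurable_continuous_onI continuous_intros)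

text \<open>No Riesz representation is needed for the measurability of \<open>s \<mapsto> G (g (s, _))\<close>: continuity
  of \<open>G\<close> under dominated convergence carries it from rectangles to Borel sets, and then from simple
  functions to \<open>g\<close>.\<close>

lemma functional_section_indicator_measurable:
  fixes A :: "(real \<times> real) set"
  assumes G: "L2_functional S B J G" and S: "S \<in> lmeasurable" and A: "A \<in> sets borel"
  shows "(\<lambda>s. G (\<lambda>t. indicator A (s, t))) \<in> borel_measurable borel"
proof -
  let ?R = "{a \<times> b |a b. a \<in> sets (borel::real measure) \<and> b \<in> sets (borel::real measure)}"
  have lin: "linear_on_L2 S G" and S': "S \<in> sets lebesgue"
    using G S by (auto simp: L2_functional_def)
  have gen: "sets (borel :: (real \<times> real) measure) = sigma_sets UNIV ?R"
    unfolding borel_prod[symmetric] sets_pair_measure by simp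
  have sec: "(\<lambda>t. indicator A (s, t)) \<in> L2 S" if "A \<in> sets borel" for A :: "(real \<times> real) set" and s
    using that by (intro L2_bounded[OF S, where c = 1] section_borel) (auto simp: indicator_def)
  have "Int_stable ?R"
    by (auto simp: Int_stable_def Times_Int_Times) blast
  moreover have "?R \<subseteq> Pow UNIV" by simp
  moreover have "A \<in> sigma_sets UNIV ?R" using A gen by simp
  ultimately show ?thesis
  proof (induction rule: sigma_sets_induct_disjoint)
    case (basic C)
    then obtain a b where C: "C = a \<times> b" and ab: "a \<in> sets borel" "b \<in> sets borel" by auto
    have b: "indicator b \<in> L2 S"
      using ab(2) by (intro L2_bounded[OF S, where c = 1]) (auto simp: indicator_def)
    have "G (\<lambda>t. indicator C (s, t)) = indicator a s * G (indicator b)" for s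
    proof -
      have "(\<lambda>t. indicator C (s, t)) = (\<lambda>t. indicator a s * indicator b t :: real)"
        by (auto simp: C indicator_def)
      then show ?thesis by (simp only: linear_on_L2_cmult[OF lin b])
    qed
    then show ?case using ab by simp
  next
    case empty
    show ?case by (simp add: linear_on_L2_zero[OF lin])
  next
    case (compl C)
    have C: "C \<in> sets borel" using compl(1) gen by simp
    have "G (\<lambda>t. indicator (UNIV - C) (s, t)) = G (\<lambda>t. 1) - G (\<lambda>t. indicator C (s, t))" for s
    proof -
      have "(\<lambda>t. indicator (UNIV - C) (s, t)) = (\<lambda>t. 1 * 1 + - 1 * indicator C (s, t) :: real)"
        by (auto simp: indicator_def)
      moreover have "(\<lambda>t. 1) \<in> L2 S" by (rule L2_bounded[OF S, where c = 1]) auto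
      ultimately show ?thesis
        using linear_on_L2D[OF lin _ sec[OF C], of "\<lambda>t. 1" 1 "-1" s] by simp
    qed
    then show ?case using compl(2) by simp
  next
    case (union D)
    have D: "D i \<in> sets borel" for i using union(2) gen by auto
    have one: "(\<lambda>t. 1) \<in> L2 S" by (rule L2_bounded[OF S, where c = 1]) auto
    \<comment> \<open>Linearity handles finite disjoint unions. The countable union is a limit under
      the majorant 1, which lies in \<open>L2 S\<close> because \<open>S\<close> has finite
      measure.\<close>
    have "(\<lambda>n. \<Sum>i<n. G (\<lambda>t. indicator (D i) (s, t))) \<longlonglongrightarrow> G (\<lambda>t. indicator (\<Union>i. D i) (s, t))" for s
    proof -
      have "(\<lambda>n. G (\<lambda>t. indicator (\<Union>i<n. D i) (s, t))) \<longlonglongrightarrow> G (\<lambda>t. indicator (\<Union>i. D i) (s, t))"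
      proof (rule L2_functional_tendsto[OF G S' one])
        show "(\<lambda>t. indicator (\<Union>i<n. D i) (s, t) :: real) \<in> borel_measurable (lebesgue_on S)" for n
          by (rule L2_measurable[OF sec]) (use D in auto)
        show "(\<lambda>n. indicator (\<Union>i<n. D i) (s, t) :: real) \<longlonglongrightarrow> indicator (\<Union>i. D i) (s, t)" for t
          by (rule LIMSEQ_indicator_UN)
      qed (auto simp: indicator_def)
      moreover have "G (\<lambda>t. indicator (\<Union>i<n. D i) (s, t)) = (\<Sum>i<n. G (\<lambda>t. indicator (D i) (s, t)))" for n
      proof -
        have "(\<lambda>t. indicator (\<Union>i<n. D i) (s, t)) = (\<lambda>t. \<Sum>i<n. 1 * indicator (D i) (s, t) :: real)"
          using union(1)
          by (auto simp: fun_eq_iff disjoint_family_on_def intro!: indicator_UN_disjoint)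
        then show ?thesis by (simp only: linear_on_L2_sum[OF lin sec[OF D]]) simp
      qed
      ultimately show ?thesis by simp
    qed
    then show ?case
      by (rule borel_measurable_LIMSEQ_real) (use union(3) in simp)
  qed
qed

text \<open>Off \<open>X\<close> a section need not be square-integrable, and the bound of
  \<open>G\<close> says nothing about it; hence the default value 0.\<close>

lemma functional_section_measurable:
  fixes g :: "real \<times> real \<Rightarrow> real"
  assumes G: "L2_functional S B J G" and S: "S \<in> lmeasurable" and g: "g \<in> borel_measurable borel"
    and X: "X \<in> sets borel" "\<And>s. s \<in> X \<Longrightarrow> (\<lambda>t. g (s, t)) \<in> L2 S"
  shows "(\<lambda>s. if s \<in> X then G (\<lambda>t. g (s, t)) else 0) \<in> borel_measurable borel"
proof -
  have lin: "linear_on_L2 S G" and S': "S \<in> sets lebesgue"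
    using G S by (auto simp: L2_functional_def)
  \<comment> \<open>Simple functions bounded by 2 |g|: on sections in \<open>L2 S\<close> this is
    the majorant for \<open>L2_functional_tendsto\<close>.\<close>
  obtain f where f: "\<And>i. simple_function borel (f i)" "\<And>x. (\<lambda>i. f i x) \<longlonglongrightarrow> g x"
      "\<And>i x. dist (f i x) 0 \<le> 2 * dist (g x) 0"
    using borel_measurable_implies_sequence_metric[OF g, of 0] by (auto simp: space_borel)
  have fm: "f i \<in> borel_measurable borel" for i by (rule borel_measurable_simple_function[OF f(1)])
  have sm: "(\<lambda>s. G (\<lambda>t. f i (s, t))) \<in> borel_measurable borel" for i
  proof -
    let ?Y = "range (f i)"
    have fin: "finite ?Y" using f(1)[of i] by (simp add: simple_function_def)
    have P: "f i -` {y} \<in> sets borel" for y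
      using measurable_sets[OF fm, of "{y}" i] by simp
    have sec: "(\<lambda>t. indicator (f i -` {y}) (s, t)) \<in> L2 S" for y s
      using P by (intro L2_bounded[OF S, where c = 1] section_borel) (auto split: split_indicator)
    have "G (\<lambda>t. f i (s, t)) = (\<Sum>y\<in>?Y. y * G (\<lambda>t. indicator (f i -` {y}) (s, t)))" for s
    proof -
      have "f i x = (\<Sum>y\<in>?Y. y * indicator (f i -` {y}) x)" for x
      proof -
        have "(\<Sum>y\<in>?Y. y * indicator (f i -` {y}) x) = (\<Sum>y\<in>?Y. if y = f i x then y else 0)"
          by (intro sum.cong) (auto simp: indicator_def)
        also have "\<dots> = f i x" using fin by (subst sum.delta) auto
        finally show ?thesis by simp
      qed
      then have "(\<lambda>t. f i (s, t)) = (\<lambda>t. \<Sum>y\<in>?Y. y * indicator (f i -` {y}) (s, t))"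
        by (rule ext)
      then show ?thesis by (simp only: linear_on_L2_sum[OF lin sec])
    qed
    then show ?thesis
      using functional_section_indicator_measurable[OF G S P] by simp
  qed
  have "(\<lambda>i. if s \<in> X then G (\<lambda>t. f i (s, t)) else 0) \<longlonglongrightarrow> (if s \<in> X then G (\<lambda>t. g (s, t)) else 0)" for s
  proof (cases "s \<in> X")
    case True
    have "(\<lambda>t. 2 * \<bar>g (s, t)\<bar>) \<in> L2 S"
      using X(2)[OF True] by (auto simp: L2_def power_mult_distrib)
    then have "(\<lambda>i. G (\<lambda>t. f i (s, t))) \<longlonglongrightarrow> G (\<lambda>t. g (s, t))"
    proof (rule L2_functional_tendsto[OF G S'])
      show "(\<lambda>t. f i (s, t)) \<in> borel_measurable (lebesgue_on S)" for i
        using section_borel[OF fm] by (intro measurable_restrict_space1 measurable_completion) simp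
    qed (use f in auto)
    then show ?thesis using True by simp
  qed simp
  then show ?thesis
    by (rule borel_measurable_LIMSEQ_real) (use sm X(1) in measurable)
qed

lemma nn_integral_lborel_prod:
  fixes f :: "real \<times> real \<Rightarrow> ennreal"
  assumes "f \<in> borel_measurable borel"
  shows "(\<integral>\<^sup>+x. f x \<partial>lborel) = (\<integral>\<^sup>+s. \<integral>\<^sup>+t. f (s, t) \<partial>lborel \<partial>lborel)"
  using lborel.nn_integral_fst[of f lborel] assms by (simp add: lborel_prod)

lemma nn_integral_section_measurable:
  fixes f :: "real \<times> real \<Rightarrow> ennreal"
  assumes "f \<in> borel_measurable borel"
  shows "(\<lambda>s. \<integral>\<^sup>+t. f (s, t) \<partial>lborel) \<in> borel_measurable borel"
  using lborel.borel_measurable_nn_integral_fst[of f lborel] assms by (simp add: lborel_prod)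

text \<open>The bound of \<open>G\<close> on each section, followed by that of \<open>F\<close>,
  multiplies the constants by Tonelli. The Borel representative \<open>g\<close> makes every section
  measurable, as a Lebesgue measurable \<open>f\<close> need not.\<close>

lemma tensor_functional_bound:
  fixes f g :: "real \<times> real \<Rightarrow> real"
  assumes F: "L2_functional S A I F" and G: "L2_functional S B J G" and S: "S \<in> lmeasurable"
    and g: "g \<in> borel_measurable borel" and fg: "AE x in lborel. f x = g x"
    and fin: "(\<integral>\<^sup>+x. ennreal ((g x)\<^sup>2) \<partial>lborel) < \<infinity>"
  shows "ennreal ((F (\<lambda>s. G (\<lambda>t. f (s, t))))\<^sup>2) \<le>
           ennreal A * ennreal B * (\<integral>\<^sup>+x. ennreal ((g x)\<^sup>2) * indicator (I \<times> J) x \<partial>lborel)"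
proof -
  have S': "S \<in> sets lebesgue" using S by auto
  have IJ: "I \<in> sets borel" "J \<in> sets borel" "I \<subseteq> S" "J \<subseteq> S"
    using F G by (auto simp: L2_functional_def)
  have IJL: "I \<in> sets lebesgue" "J \<in> sets lebesgue" using IJ by auto
  have IxJ: "I \<times> J \<in> sets borel" using IJ by (simp add: borel_Times)
  note [measurable] = g IJ(1,2) IxJ
  define N where "N s = (\<integral>\<^sup>+t. ennreal ((g (s, t))\<^sup>2) \<partial>lborel)" for s
  have N [measurable]: "N \<in> borel_measurable borel"
    unfolding N_def[abs_def] by (rule nn_integral_section_measurable[of "\<lambda>x. ennreal ((g x)\<^sup>2)"]) measurable
  have "(\<integral>\<^sup>+s. N s \<partial>lborel) < \<infinity>"
    using fin nn_integral_lborel_prod[of "\<lambda>x. ennreal ((g x)\<^sup>2)"] by (simp add: N_def)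
  then have ae1: "AE s in lborel. N s \<noteq> \<infinity>"
    by (intro nn_integral_noteq_infinite) auto
  define X where "X = {s. N s < \<infinity>}"
  have X [measurable]: "X \<in> sets borel" unfolding X_def by measurable
  have gL: "sqint S (\<lambda>t. g (s, t)) < \<infinity>" if "s \<in> X" for s
  proof -
    have "sqint S (\<lambda>t. g (s, t)) \<le> N s"
      unfolding sqint_eq[OF S'] N_def by (rule nn_integral_mono) (auto simp: indicator_def)
    then show ?thesis using that by (auto simp: X_def)
  qed
  have gX: "(\<lambda>t. g (s, t)) \<in> L2 S" if "s \<in> X" for s
    by (rule L2_AE_eq[OF S' _ section_borel[OF g] gL[OF that]]) simp
  \<comment> \<open>A measurable version of the inner function: it is 0 at the s whose section has
    infinite integral, a null set by \<open>ae1\<close>.\<close>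
  define H where "H s = (if s \<in> X then G (\<lambda>t. g (s, t)) else 0)" for s
  have H [measurable]: "H \<in> borel_measurable borel"
    unfolding H_def[abs_def] by (rule functional_section_measurable[OF G S g X gX])
  have HB: "ennreal ((H s)\<^sup>2) \<le> ennreal B * (\<integral>\<^sup>+t. ennreal ((g (s, t))\<^sup>2) * indicator J t \<partial>lborel)" for s
    using G gX[of s] by (auto simp: H_def L2_functional_def sqint_eq[OF IJL(2)])
  have "AE x in lborel \<Otimes>\<^sub>M lborel. f x = g x" using fg by (simp only: lborel_prod)
  then have ae2: "AE s in lborel. AE t in lborel. f (s, t) = g (s, t)"
    by (rule lborel_pair.AE_pair)
  have ae: "AE s in lborel. G (\<lambda>t. f (s, t)) = H s"
    using ae1 ae2
  proof eventually_elim
    case (elim s)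
    then have s: "s \<in> X" by (auto simp: X_def top.not_eq_extremum)
    have "(\<lambda>t. f (s, t)) \<in> L2 S"
      by (rule L2_AE_eq[OF S' elim(2) section_borel[OF g] gL[OF s]])
    then show ?case
      using L2_functional_cong_AE[OF G _ gX[OF s] elim(2)] s by (simp add: H_def)
  qed
  \<comment> \<open>Used twice: with \<open>UNIV\<close> to show that the inner function is
    square-integrable, then with \<open>I\<close> for the estimate itself.\<close>
  have sqH: "(\<integral>\<^sup>+s. ennreal ((H s)\<^sup>2) * indicator I' s \<partial>lborel) \<le>
      ennreal B * (\<integral>\<^sup>+x. ennreal ((g x)\<^sup>2) * indicator (I' \<times> J) x \<partial>lborel)" if [measurable]: "I' \<in> sets borel" for I'
  proof -
    have [measurable]: "I' \<times> J \<in> sets borel" using IJ that by (simp add: borel_Times)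
    have m: "(\<lambda>x. ennreal ((g x)\<^sup>2) * indicator (I' \<times> J) x) \<in> borel_measurable borel" by measurable
    have "(\<integral>\<^sup>+s. ennreal ((H s)\<^sup>2) * indicator I' s \<partial>lborel)
        \<le> (\<integral>\<^sup>+s. ennreal B * (\<integral>\<^sup>+t. ennreal ((g (s, t))\<^sup>2) * indicator (I' \<times> J) (s, t) \<partial>lborel) \<partial>lborel)"
      using HB by (intro nn_integral_mono) (auto simp: indicator_def split: if_splits)
    also have "\<dots> = ennreal B * (\<integral>\<^sup>+x. ennreal ((g x)\<^sup>2) * indicator (I' \<times> J) x \<partial>lborel)"
      using nn_integral_section_measurable[OF m] by (simp add: nn_integral_lborel_prod[OF m] nn_integral_cmult)
    finally show ?thesis .
  qed
  have "sqint S H \<le> (\<integral>\<^sup>+s. ennreal ((H s)\<^sup>2) * indicator UNIV s \<partial>lborel)"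
    unfolding sqint_eq[OF S'] by (rule nn_integral_mono) (auto simp: indicator_def)
  also have "\<dots> \<le> ennreal B * (\<integral>\<^sup>+x. ennreal ((g x)\<^sup>2) * indicator (UNIV \<times> J) x \<partial>lborel)"
    by (rule sqH) simp
  also have "\<dots> \<le> ennreal B * (\<integral>\<^sup>+x. ennreal ((g x)\<^sup>2) \<partial>lborel)"
    by (intro mult_left_mono nn_integral_mono) (auto simp: indicator_def)
  also have "\<dots> < \<infinity>" using fin by (simp add: ennreal_mult_less_top)
  finally have "(\<lambda>s. G (\<lambda>t. f (s, t))) \<in> L2 S"
    by (rule L2_AE_eq[OF S' ae H])
  then have "ennreal ((F (\<lambda>s. G (\<lambda>t. f (s, t))))\<^sup>2) \<le> ennreal A * sqint I (\<lambda>s. G (\<lambda>t. f (s, t)))"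
    using F by (auto simp: L2_functional_def)
  also have "sqint I (\<lambda>s. G (\<lambda>t. f (s, t))) = (\<integral>\<^sup>+s. ennreal ((H s)\<^sup>2) * indicator I s \<partial>lborel)"
    unfolding sqint_eq[OF IJL(1)] by (rule nn_integral_cong_AE) (use ae in auto)
  also have "ennreal A * \<dots> \<le> ennreal A * (ennreal B * (\<integral>\<^sup>+x. ennreal ((g x)\<^sup>2) * indicator (I \<times> J) x \<partial>lborel))"
    by (intro mult_left_mono sqH) auto
  finally show ?thesis by (simp add: mult.assoc)
qed

section \<open>Geometry of the triangle\<close>

lemma Delta_open: "open (Delta c)"
proof -
  have "Delta c = {x. 0 < fst x} \<inter> {x. fst x < c} \<inter> {x. 0 < snd x} \<inter> {x. snd x < fst x}"
    by (auto simp: Delta_def)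
  then show ?thesis
    by (auto intro!: open_Int open_Collect_less continuous_intros)
qed

lemma sing_map_borel [measurable]: "sing_map \<in> borel_measurable borel"
  unfolding sing_map_def case_prod_beta
  by (intro borel_measurable_continuous_onI continuous_intros)

lemma fst_borel [measurable]: "fst \<in> borel_measurable (borel :: (real \<times> real) measure)"
  by (intro borel_measurable_continuous_onI continuous_intros)

lemma snd_borel [measurable]: "snd \<in> borel_measurable (borel :: (real \<times> real) measure)"
  by (intro borel_measurable_continuous_onI continuous_intros)

text \<open>For fixed s > 0 the substitution v = s * t is affine with factor s, so Tonelli and the
  one-dimensional rule yield the Jacobian. The indicators restrict to s > 0, where 1 / s is the
  density.\<close>

lemma nn_integral_sing_map:
  fixes w :: "real \<times> real \<Rightarrow> ennreal"
  assumes [measurable]: "w \<in> borel_measurable borel"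
  shows "(\<integral>\<^sup>+x. w (sing_map x) * indicator {0<..} (fst x) \<partial>lborel) =
         (\<integral>\<^sup>+x. w x * ennreal (1 / fst x) * indicator {0<..} (fst x) \<partial>lborel)"
proof -
  have [measurable]: "(\<lambda>t. w (s, t)) \<in> borel_measurable borel" for s
    by (rule section_borel) fact
  have "(\<integral>\<^sup>+x. w (sing_map x) * indicator {0<..} (fst x) \<partial>lborel) =
      (\<integral>\<^sup>+s. \<integral>\<^sup>+t. w (s, s * t) * indicator {0<..} s \<partial>lborel \<partial>lborel)"
    by (subst nn_integral_lborel_prod) (simp_all add: sing_map_def)
  also have "\<dots> = (\<integral>\<^sup>+s. \<integral>\<^sup>+v. w (s, v) * ennreal (1 / s) * indicator {0<..} s \<partial>lborel \<partial>lborel)"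
  proof (rule nn_integral_cong)
    fix s :: real
    show "(\<integral>\<^sup>+t. w (s, s * t) * indicator {0<..} s \<partial>lborel) =
        (\<integral>\<^sup>+v. w (s, v) * ennreal (1 / s) * indicator {0<..} s \<partial>lborel)"
    proof (cases "0 < s")
      case True
      have "(\<integral>\<^sup>+v. w (s, v) * ennreal (1 / s) \<partial>lborel) = ennreal (1 / s) * (\<integral>\<^sup>+v. w (s, v) \<partial>lborel)"
        by (subst nn_integral_multc) (simp_all add: section_borel mult.commute)
      also have "\<dots> = ennreal (1 / s) * (ennreal s * (\<integral>\<^sup>+t. w (s, s * t) \<partial>lborel))"
        using nn_integral_real_affine[of "\<lambda>v. w (s, v)" s 0] True by simp
      also have "\<dots> = (\<integral>\<^sup>+t. w (s, s * t) \<partial>lborel)"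
        using True by (simp add: mult.assoc[symmetric] ennreal_mult[symmetric])
      finally show ?thesis using True by simp
    qed simp
  qed
  also have "\<dots> = (\<integral>\<^sup>+x. w x * ennreal (1 / fst x) * indicator {0<..} (fst x) \<partial>lborel)"
    by (subst nn_integral_lborel_prod) simp_all
  finally show ?thesis .
qed

text \<open>Formulated for \<open>lebesgue\<close> because composing a Lebesgue measurable function
  with a map requires preimages of Lebesgue sets to be Lebesgue sets.\<close>

lemma scale_map_lebesgue:
  assumes "c \<noteq> 0"
  shows "scale_map c \<in> lebesgue \<rightarrow>\<^sub>M lebesgue"
    and "lebesgue = density (distr lebesgue lebesgue (scale_map c)) (\<lambda>_. ennreal (c\<^sup>2))"
proof -
  have T: "(\<lambda>x. 0 + (\<Sum>j\<in>Basis. (c * (x \<bullet> j)) *\<^sub>R j)) = scale_map c"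
    by (auto simp: scale_map_def Basis_prod_def sum.union_disjoint fun_eq_iff inner_prod_def
        sum.reindex inj_on_def)
  show "scale_map c \<in> lebesgue \<rightarrow>\<^sub>M lebesgue"
    using lebesgue_affine_measurable[of "\<lambda>_. c" "0 :: real \<times> real"] assms unfolding T by simp
  have "(\<Prod>j\<in>(Basis :: (real \<times> real) set). \<bar>c\<bar>) = c\<^sup>2" by (simp add: power2_eq_square)
  then show "lebesgue = density (distr lebesgue lebesgue (scale_map c)) (\<lambda>_. ennreal (c\<^sup>2))"
    using lebesgue_affine_euclidean[of "\<lambda>_. c" "0 :: real \<times> real"] assms unfolding T by simp
qed

text \<open>The factor 1 / c is the square root of the ratio of areas. Multiplying
  \<open>\<phi>\<close> by the indicator extends it by 0, so that the transformation rule for the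
  whole plane applies.\<close>

lemma L2_scale_map:
  assumes "0 < c" "\<phi> \<in> L2 (Delta (c * \<gamma>))"
  shows "\<phi> \<circ> scale_map c \<in> L2 (Delta \<gamma>)"
    and "L2_norm (Delta \<gamma>) (\<phi> \<circ> scale_map c) = L2_norm (Delta (c * \<gamma>)) \<phi> / c"
proof -
  have D: "Delta r \<in> sets lebesgue" for r using Delta_open[of r] by auto
  have ind: "indicator (Delta (c * \<gamma>)) (scale_map c x) = (indicator (Delta \<gamma>) x :: 'a::zero_neq_one)" for x
    using assms(1) by (auto simp: indicator_def Delta_def scale_map_def zero_less_mult_iff)
  have meas: "(\<lambda>x. indicator (Delta (c * \<gamma>)) x *\<^sub>R \<phi> x) \<in> borel_measurable lebesgue"
    using L2_measurable[OF assms(2)] D by (subst borel_measurable_restrict_space_iff[symmetric]) auto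
  note sc = scale_map_lebesgue[of c]
  have "(\<lambda>x. indicator (Delta (c * \<gamma>)) (scale_map c x) *\<^sub>R \<phi> (scale_map c x)) \<in> borel_measurable lebesgue"
    using sc(1) assms(1) meas by (rule_tac measurable_compose[of "scale_map c"]) auto
  then have m2: "\<phi> \<circ> scale_map c \<in> borel_measurable (lebesgue_on (Delta \<gamma>))"
    unfolding ind using D by (subst borel_measurable_restrict_space_iff) (auto simp: comp_def)
  have meas2: "(\<lambda>x. ennreal ((indicator (Delta (c * \<gamma>)) x *\<^sub>R \<phi> x)\<^sup>2)) \<in> borel_measurable lebesgue"
    using meas by measurable
  have "sqint (Delta (c * \<gamma>)) \<phi> = (\<integral>\<^sup>+x. ennreal ((indicator (Delta (c * \<gamma>)) x *\<^sub>R \<phi> x)\<^sup>2) \<partial>lebesgue)"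
    unfolding sqint_eq[OF D] nn_integral_completion by (rule nn_integral_cong) (auto simp: indicator_def)
  also have "\<dots> = ennreal (c\<^sup>2) * (\<integral>\<^sup>+x. ennreal ((indicator (Delta (c * \<gamma>)) (scale_map c x) *\<^sub>R \<phi> (scale_map c x))\<^sup>2) \<partial>lebesgue)"
    by (subst sc(2)) (use assms(1) sc(1) meas2 in \<open>simp_all add: nn_integral_density nn_integral_distr nn_integral_cmult\<close>)
  also have "(\<integral>\<^sup>+x. ennreal ((indicator (Delta (c * \<gamma>)) (scale_map c x) *\<^sub>R \<phi> (scale_map c x))\<^sup>2) \<partial>lebesgue) = sqint (Delta \<gamma>) (\<phi> \<circ> scale_map c)"
    unfolding sqint_eq[OF D] nn_integral_completion ind by (rule nn_integral_cong) (auto simp: indicator_def)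
  finally have eq: "sqint (Delta (c * \<gamma>)) \<phi> = ennreal (c\<^sup>2) * sqint (Delta \<gamma>) (\<phi> \<circ> scale_map c)" .
  have "sqint (Delta \<gamma>) (\<phi> \<circ> scale_map c) < \<infinity>"
    using sqint_finite[OF assms(2)] assms(1) unfolding eq by (auto simp: ennreal_mult_less_top)
  with m2 show L: "\<phi> \<circ> scale_map c \<in> L2 (Delta \<gamma>)" by (rule L2_I)
  have "(L2_norm (Delta (c * \<gamma>)) \<phi>)\<^sup>2 = (c * L2_norm (Delta \<gamma>) (\<phi> \<circ> scale_map c))\<^sup>2"
    using eq by (simp add: sqint_L2[OF assms(2)] sqint_L2[OF L] ennreal_mult[symmetric] power_mult_distrib)
  then have "L2_norm (Delta (c * \<gamma>)) \<phi> = c * L2_norm (Delta \<gamma>) (\<phi> \<circ> scale_map c)"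
    using assms(1) by (simp add: power2_eq_iff_nonneg L2_norm_nonneg)
  then show "L2_norm (Delta \<gamma>) (\<phi> \<circ> scale_map c) = L2_norm (Delta (c * \<gamma>)) \<phi> / c"
    using assms(1) by simp
qed

text \<open>The image of a rectangle under \<open>sing_map\<close> when
  \<open>0 \<le> \<alpha>\<close>, with the slope conditions free of division: openness and the
  effect of halving are then immediate.\<close>

definition wedge :: "real \<Rightarrow> real \<Rightarrow> real \<Rightarrow> real \<Rightarrow> (real \<times> real) set" where
  "wedge \<alpha> \<beta> \<gamma> \<eta> = {(u, v). \<alpha> < u \<and> u < \<beta> \<and> \<gamma> * u < v \<and> v < \<eta> * u}"

lemma open_wedge: "open (wedge \<alpha> \<beta> \<gamma> \<eta>)"
proof -
  have "wedge \<alpha> \<beta> \<gamma> \<eta> =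
      {x. \<alpha> < fst x} \<inter> {x. fst x < \<beta>} \<inter> {x. \<gamma> * fst x < snd x} \<inter> {x. snd x < \<eta> * fst x}"
    by (auto simp: wedge_def)
  then show ?thesis
    by (auto intro!: open_Int open_Collect_less continuous_intros)
qed

lemma sing_map_rectangle:
  assumes "0 \<le> \<alpha>"
  shows "sing_map ` ({\<alpha><..<\<beta>} \<times> {\<gamma><..<\<eta>}) = wedge \<alpha> \<beta> \<gamma> \<eta>"
proof (intro equalityI subsetI)
  fix x assume "x \<in> wedge \<alpha> \<beta> \<gamma> \<eta>"
  then have "x = sing_map (fst x, snd x / fst x)" "(fst x, snd x / fst x) \<in> {\<alpha><..<\<beta>} \<times> {\<gamma><..<\<eta>}"
    using assms by (auto simp: wedge_def sing_map_def field_simps)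
  then show "x \<in> sing_map ` ({\<alpha><..<\<beta>} \<times> {\<gamma><..<\<eta>})" by (rule image_eqI)
qed (use assms in \<open>auto simp: wedge_def sing_map_def mult.commute\<close>)

lemma wedge_slope:
  assumes "0 \<le> \<alpha>" "(u, v) \<in> wedge \<alpha> \<beta> \<gamma> \<eta>"
  shows "0 < u" "\<gamma> < v / u" "v / u < \<eta>"
  using assms by (auto simp: wedge_def field_simps)

lemma wedge_subset_Delta:
  assumes "0 \<le> \<alpha>" "\<beta> \<le> 1" "0 \<le> \<gamma>" "\<eta> \<le> 1"
  shows "wedge \<alpha> \<beta> \<gamma> \<eta> \<subseteq> Delta 1"
proof
  fix x assume x: "x \<in> wedge \<alpha> \<beta> \<gamma> \<eta>"
  obtain u v where uv: "x = (u, v)" by (cases x)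
  have "0 < u" using wedge_slope(1)[OF assms(1)] x uv by blast
  then have "0 \<le> \<gamma> * u" "\<eta> * u \<le> u" using assms by (simp_all add: mult_left_le_one_le)
  moreover have "\<alpha> < u" "u < \<beta>" "\<gamma> * u < v" "v < \<eta> * u" using x by (auto simp: uv wedge_def)
  ultimately have "u < 1" "0 < v" "v < u" using assms by linarith+
  then show "x \<in> Delta 1" using \<open>0 < u\<close> by (simp add: uv Delta_def)
qed

definition cell :: "nat \<Rightarrow> nat \<Rightarrow> nat \<Rightarrow> nat \<Rightarrow> (real \<times> real) set" where
  "cell n m a c =
     wedge ((real a - 1) / 2 ^ n) (real a / 2 ^ n) ((real c - 1) / 2 ^ m) (real c / 2 ^ m)"

text \<open>Halving towards the tip refines u but preserves the slope v / u, so a cell has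
  resolution 2^-n in u and 2^-m in slope. The condition \<open>a \<le> 2 ^ m\<close> ties the
  distance from the tip to the slope resolution; both the area bound and the count of active
  functions rely on it.\<close>

lemma hier_mesh_cell:
  assumes "\<delta> \<in> hier_mesh n"
  obtains m a c where "m \<le> n" "1 \<le> a" "a \<le> 2 ^ m" "1 \<le> c" "c \<le> 2 ^ m" "\<delta> = cell n m a c"
  using assms
proof (induction n arbitrary: \<delta> thesis)
  case 0
  have "Delta 1 = cell 0 0 1 1" by (auto simp: Delta_def cell_def wedge_def)
  then show ?case using 0 by (auto intro!: "0.prems"(1)[of 0 1 1])
next
  case (Suc n)
  consider "\<delta> \<in> mesh (Suc n)" | \<delta>' where "\<delta>' \<in> hier_mesh n" "\<delta> = (\<lambda>(u, v). (u / 2, v / 2)) ` \<delta>'"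
    using Suc.prems(2) by auto
  then show ?case
  proof cases
    case 1
    then obtain a c :: nat where ac: "1 \<le> a" "a \<le> 2 ^ Suc n" "1 \<le> c" "c \<le> 2 ^ Suc n"
      "\<delta> = sing_map ` ({(real a - 1) / 2 ^ Suc n <..< real a / 2 ^ Suc n} \<times>
                  {(real c - 1) / 2 ^ Suc n <..< real c / 2 ^ Suc n})"
      unfolding mesh_def by blast
    show ?thesis
    proof (rule Suc.prems(1)[OF _ ac(1-4)])
      show "\<delta> = cell (Suc n) (Suc n) a c"
        unfolding ac(5) cell_def using ac(1) by (intro sing_map_rectangle) simp
    qed simp
  next
    case 2
    obtain m a c where *: "m \<le> n" "1 \<le> a" "a \<le> 2 ^ m" "1 \<le> c" "c \<le> 2 ^ m" "\<delta>' = cell n m a c"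
      using Suc.IH[OF _ 2(1)] by blast
    show ?thesis
    proof (rule Suc.prems(1)[OF _ *(2-5)])
      show "\<delta> = cell (Suc n) m a c"
      proof (intro equalityI subsetI)
        fix x assume "x \<in> cell (Suc n) m a c"
        then have "(2 * fst x, 2 * snd x) \<in> \<delta>'" "x = (\<lambda>(u, v). (u / 2, v / 2)) (2 * fst x, 2 * snd x)"
          by (auto simp: *(6) cell_def wedge_def field_simps)
        then show "x \<in> \<delta>" unfolding 2(2) by blast
      qed (auto simp: 2(2) *(6) cell_def wedge_def field_simps)
    qed (use * in simp)
  qed
qed

text \<open>The slice at s has length s / 2^m, where s is at most a / 2^n. As
  \<open>a \<le> 2 ^ m\<close>, this is at most 2^-n, which is also the width of the cell in
  u.\<close>

lemma emeasure_cell_le: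
  assumes "1 \<le> a" "a \<le> 2 ^ m" "1 \<le> c"
  shows "emeasure lborel (cell n m a c) \<le> ennreal (1 / 4 ^ n)"
proof -
  let ?I = "{(real a - 1) / 2 ^ n .. real a / 2 ^ n}"
  have [measurable]: "cell n m a c \<in> sets borel" using open_wedge by (auto simp: cell_def)
  have a: "real a \<le> 2 ^ m"
  proof -
    have "real a \<le> real (2 ^ m)" using assms(2) by (subst of_nat_le_iff)
    then show ?thesis by simp
  qed
  have "emeasure lborel (cell n m a c) = (\<integral>\<^sup>+x. indicator (cell n m a c) x \<partial>lborel)" by simp
  also have "\<dots> = (\<integral>\<^sup>+s. \<integral>\<^sup>+t. indicator (cell n m a c) (s, t) \<partial>lborel \<partial>lborel)"
    by (rule nn_integral_lborel_prod) simp
  also have "\<dots> \<le> (\<integral>\<^sup>+s. ennreal (1 / 2 ^ n) * indicator ?I s \<partial>lborel)"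
  proof (rule nn_integral_mono)
    fix s :: real
    show "(\<integral>\<^sup>+t. indicator (cell n m a c) (s, t) \<partial>lborel) \<le> ennreal (1 / 2 ^ n) * indicator ?I s"
    proof (cases "s \<in> ?I")
      case True
      then have s0: "0 \<le> s" using assms(1) order_trans[of 0 "(real a - 1) / 2 ^ n" s] by auto
      have "(\<integral>\<^sup>+t. indicator (cell n m a c) (s, t) \<partial>lborel) \<le>
          (\<integral>\<^sup>+t. indicator {(real c - 1) / 2 ^ m * s .. real c / 2 ^ m * s} t \<partial>lborel)"
        by (rule nn_integral_mono) (auto simp: indicator_def cell_def wedge_def)
      also have "\<dots> = ennreal (real c / 2 ^ m * s - (real c - 1) / 2 ^ m * s)"
        using s0 by (simp add: mult_right_mono divide_right_mono)
      also have "real c / 2 ^ m * s - (real c - 1) / 2 ^ m * s = s / 2 ^ m"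
        by (simp add: field_simps)
      also have "s / 2 ^ m \<le> (real a / 2 ^ n) / 2 ^ m"
        using True by (intro divide_right_mono) auto
      also have "\<dots> \<le> 1 / 2 ^ n"
        using a by (simp add: field_simps)
      finally show ?thesis using True by (simp add: ennreal_leI)
    next
      case False
      then have "indicator (cell n m a c) (s, t) = (0 :: ennreal)" for t
        by (auto simp: indicator_def cell_def wedge_def)
      then show ?thesis by simp
    qed
  qed
  also have "\<dots> = ennreal (1 / 2 ^ n) * ennreal (real a / 2 ^ n - (real a - 1) / 2 ^ n)"
    by (simp add: nn_integral_cmult divide_right_mono)
  also have "\<dots> = ennreal (1 / 4 ^ n)"
    by (simp add: ennreal_mult[symmetric] diff_divide_distrib[symmetric] power_mult_distrib[symmetric])
  finally show ?thesis .
qed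

text \<open>Integrating the indicator of a null set by the change of variables shows that its
  preimage in s > 0 is null. This transports equality with a Borel representative to the parameter
  square.\<close>

lemma AE_sing_map:
  assumes "AE x in lborel. P x"
  shows "AE x in lborel. 0 < fst x \<longrightarrow> P (sing_map x)"
proof -
  obtain N where N: "{x \<in> space lborel. \<not> P x} \<subseteq> N" "emeasure lborel N = 0" "N \<in> sets lborel"
    using AE_E[OF assms] by blast
  have [measurable]: "N \<in> sets borel" using N(3) by simp
  have "AE x in lborel. x \<notin> N" using N by (intro AE_not_in) (auto simp: null_sets_def)
  then have "(\<integral>\<^sup>+x. indicator N x * ennreal (1 / fst x) * indicator {0<..} (fst x) \<partial>lborel) =
      (\<integral>\<^sup>+x. 0 \<partial>(lborel :: (real \<times> real) measure))"
    by (intro nn_integral_cong_AE) auto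
  then have "(\<integral>\<^sup>+x. indicator N (sing_map x) * indicator {0<..} (fst x) \<partial>lborel) = (0::ennreal)"
    by (simp add: nn_integral_sing_map)
  then have "AE x in lborel. indicator N (sing_map x) * indicator {0<..} (fst x) = (0::ennreal)"
    by (subst (asm) nn_integral_0_iff_AE) auto
  then show ?thesis
    by eventually_elim (use N(1) in \<open>auto simp: indicator_def split: if_splits\<close>)
qed

lemma nn_integral_sing_map_le:
  fixes w :: "real \<times> real \<Rightarrow> ennreal"
  assumes [measurable]: "w \<in> borel_measurable borel" "W \<in> sets borel" and "0 < \<alpha>"
    and R: "\<And>x. x \<in> R \<Longrightarrow> \<alpha> \<le> fst x \<and> sing_map x \<in> W"
  shows "(\<integral>\<^sup>+x. w (sing_map x) * indicator R x \<partial>lborel) \<le>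
           ennreal (1 / \<alpha>) * (\<integral>\<^sup>+x. w x * indicator W x \<partial>lborel)"
proof -
  \<comment> \<open>The first coordinate is unchanged by \<open>sing_map\<close>, so this indicator
    survives the change of variables and caps the density there by
    \<open>1 / \<alpha>\<close>.\<close>
  let ?w = "\<lambda>x. w x * indicator W x * indicator {\<alpha>..} (fst x)"
  have "(\<integral>\<^sup>+x. w (sing_map x) * indicator R x \<partial>lborel) \<le>
      (\<integral>\<^sup>+x. ?w (sing_map x) * indicator {0<..} (fst x) \<partial>lborel)"
  proof (rule nn_integral_mono)
    fix x :: "real \<times> real"
    show "w (sing_map x) * indicator R x \<le> ?w (sing_map x) * indicator {0<..} (fst x)"
    proof (cases "x \<in> R")
      case True
      moreover have "fst (sing_map x) = fst x" by (simp add: sing_map_def split: prod.split)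
      ultimately show ?thesis using R[OF True] assms(3) by (auto simp: indicator_def)
    qed simp
  qed
  also have "\<dots> = (\<integral>\<^sup>+x. ?w x * ennreal (1 / fst x) * indicator {0<..} (fst x) \<partial>lborel)"
    by (rule nn_integral_sing_map) measurable
  also have "\<dots> \<le> (\<integral>\<^sup>+x. ennreal (1 / \<alpha>) * (w x * indicator W x) \<partial>lborel)"
  proof (rule nn_integral_mono)
    fix x :: "real \<times> real"
    show "?w x * ennreal (1 / fst x) * indicator {0<..} (fst x) \<le> ennreal (1 / \<alpha>) * (w x * indicator W x)"
    proof (cases "\<alpha> \<le> fst x")
      case True
      then have "ennreal (1 / fst x) \<le> ennreal (1 / \<alpha>)"
        using assms(3) by (intro ennreal_leI divide_left_mono) auto
      then have "(w x * indicator W x) * ennreal (1 / fst x) \<le> (w x * indicator W x) * ennreal (1 / \<alpha>)"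
        by (rule mult_left_mono) simp
      then show ?thesis using True assms(3) by (simp add: mult.commute)
    qed simp
  qed
  also have "\<dots> = ennreal (1 / \<alpha>) * (\<integral>\<^sup>+x. w x * indicator W x \<partial>lborel)"
    by (rule nn_integral_cmult) measurable
  finally show ?thesis .
qed

section \<open>The hierarchical basis\<close>

lemma hier_index_cases:
  assumes "(k, l) \<in> hier_index p n"
  obtains (tip) "1 \<le> k" "k \<le> p + 1" "1 \<le> l" "l \<le> k"
    | (body) m where "m = level p k" "1 \<le> m" "m \<le> n" "p + 2 ^ (m - 1) + 1 \<le> k" "k \<le> p + 2 ^ m"
        "1 \<le> l" "l \<le> p + 2 ^ m" "p + 1 < k"
proof -
  consider "1 \<le> k \<and> k \<le> p + 1 \<and> 1 \<le> l \<and> l \<le> k"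
    | m where "m \<in> {1..n}" "p + 2 ^ (m - 1) + 1 \<le> k \<and> k \<le> p + 2 ^ m \<and> 1 \<le> l \<and> l \<le> p + 2 ^ m"
    using assms unfolding hier_index_def by blast
  then show thesis
  proof cases
    case 2
    have "0 < (2::nat) ^ (m - 1)" by simp
    then have "p + 1 < k" using 2(2) by linarith
    then show thesis using 2 level_eq[of m p k] by (intro body) auto
  qed (use tip in auto)
qed

lemma hier_index_le:
  assumes "(k, l) \<in> hier_index p n"
  shows "1 \<le> k" "k \<le> 2 ^ n + p" "1 \<le> l" "l \<le> 2 ^ n + p"
proof -
  have "1 \<le> k \<and> k \<le> 2 ^ n + p \<and> 1 \<le> l \<and> l \<le> 2 ^ n + p"
    using assms
  proof (cases rule: hier_index_cases)
    case tip
    moreover have "(1::nat) \<le> 2 ^ n" by simp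
    ultimately show ?thesis by linarith
  next
    case (body m)
    moreover have "(2::nat) ^ m \<le> 2 ^ n" using body(3) by simp
    ultimately show ?thesis by linarith
  qed
  then show "1 \<le> k" "k \<le> 2 ^ n + p" "1 \<le> l" "l \<le> 2 ^ n + p" by auto
qed

lemma finite_hier_index: "finite (hier_index p n)"
  by (rule finite_subset[of _ "{..2 ^ n + p} \<times> {..2 ^ n + p}"]) (auto dest: hier_index_le)

lemma borel_measurable_Bernstein [measurable]: "Bernstein n k \<in> borel_measurable borel"
  unfolding Bernstein_def by measurable

lemma hier_basis_eq:
  "hier_basis p n k l (u, v) = bspline p n k u *
     (if k \<le> p + 1 then Bernstein (k - 1) (l - 1) (v / u) else bspline p (level p k) l (v / u))"
  by (simp add: hier_basis_def bhat_def sing_map_inv_def)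

lemma borel_measurable_hier_basis: "hier_basis p n k l \<in> borel_measurable borel"
proof -
  have "(\<lambda>x. hier_basis p n k l (fst x, snd x)) \<in> borel_measurable borel"
    unfolding hier_basis_eq by measurable
  then show ?thesis by simp
qed

lemma hier_basis_le:
  assumes "(k, l) \<in> hier_index p n" "x \<in> Delta 1"
  shows "\<bar>hier_basis p n k l x\<bar> \<le> 4 ^ p"
proof -
  obtain u v where x: "x = (u, v)" by (cases x)
  have t: "0 < v / u" "v / u < 1" using assms(2) by (auto simp: x Delta_def)
  define q where "q = (if k \<le> p + 1 then Bernstein (k - 1) (l - 1) (v / u) else bspline p (level p k) l (v / u))"
  have q: "\<bar>q\<bar> \<le> 2 ^ p"
  proof (cases "k \<le> p + 1")
    case True
    have "l - 1 \<le> k - 1" by (cases rule: hier_index_cases[OF assms(1)]) (use True in auto)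
    \<comment> \<open>The Bernstein polynomials sum to 1; the bound is relaxed to
      \<open>2 ^ p\<close> to agree with the B-spline case.\<close>
    then have "Bernstein (k - 1) (l - 1) (v / u) \<le> (\<Sum>j\<le>k - 1. Bernstein (k - 1) j (v / u))"
      using t by (intro member_le_sum) (auto intro: Bernstein_nonneg)
    also have "\<dots> \<le> 2 ^ p" by simp
    finally show ?thesis using True t by (simp add: q_def Bernstein_nonneg)
  qed (simp add: q_def bspline_le bspline_nonneg)
  have "\<bar>hier_basis p n k l x\<bar> = \<bar>bspline p n k u\<bar> * \<bar>q\<bar>"
    unfolding x hier_basis_eq q_def by (simp add: abs_mult)
  also have "\<dots> \<le> 2 ^ p * 2 ^ p"
    using q by (intro mult_mono) (simp_all add: bspline_le bspline_nonneg)
  also have "\<dots> = 4 ^ p" by (simp add: power_mult_distrib[symmetric])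
  finally show ?thesis .
qed

text \<open>An open set inside the support of one active function lies in the interior of the
  union.\<close>

lemma wedge_subset_support_extension:
  assumes "(k, l) \<in> hier_index p n" "\<exists>x\<in>\<delta>. hier_basis p n k l x \<noteq> 0"
    and "wedge \<alpha> \<beta> \<gamma> \<eta> \<subseteq> Delta 1" "\<And>x. x \<in> wedge \<alpha> \<beta> \<gamma> \<eta> \<Longrightarrow> hier_basis p n k l x \<noteq> 0"
  shows "wedge \<alpha> \<beta> \<gamma> \<eta> \<subseteq> support_extension p n \<delta>"
  unfolding support_extension_def
proof (rule interior_maximal[OF _ open_wedge])
  have "wedge \<alpha> \<beta> \<gamma> \<eta> \<subseteq> supp_in (Delta 1) (hier_basis p n k l)"
    using assms(3,4) closure_subset[of "{x \<in> Delta 1. hier_basis p n k l x \<noteq> 0}"]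
    by (fastforce simp: supp_in_def)
  then show "wedge \<alpha> \<beta> \<gamma> \<eta> \<subseteq> (\<Union>(i, j)\<in>{(i, j) \<in> hier_index p n. \<exists>x\<in>\<delta>. hier_basis p n i j x \<noteq> 0}.
        supp_in (Delta 1) (hier_basis p n i j))"
    using assms(1,2) by blast
qed

lemma support_extension_subset: "support_extension p n \<delta> \<subseteq> Delta 1"
  unfolding support_extension_def
  by (rule order_trans[OF interior_subset]) (auto simp: supp_in_def)

text \<open>For \<open>k \<le> p + 1\<close> the support in u starts at 0 and reaches at least 2^-n,
  and the Bernstein factor vanishes for no slope in ]0,1[. Hence a tip functional, although it sees
  all directions at once, does not leave the support extension.\<close>

lemma tip_wedge_subset:
  assumes "(k, l) \<in> hier_index p n" "\<exists>x\<in>\<delta>. hier_basis p n k l x \<noteq> 0" "k \<le> p + 1"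
  shows "Delta (1 / 2 ^ n) \<subseteq> support_extension p n \<delta>"
proof -
  have k: "open_knot p n k = 0" using assms(3) by (simp add: open_knot_def)
  have K: "1 / 2 ^ n \<le> open_knot p n (k + p + 1)"
    using open_knot_span[of k n p] hier_index_le[OF assms(1)] k by simp
  have D: "Delta (1 / 2 ^ n) = wedge 0 (1 / 2 ^ n) 0 1"
    by (auto simp: Delta_def wedge_def)
  show ?thesis
    unfolding D
  proof (rule wedge_subset_support_extension[OF assms(1,2)])
    show "wedge 0 (1 / 2 ^ n) 0 1 \<subseteq> Delta 1" by (rule wedge_subset_Delta) auto
    fix x assume "x \<in> wedge 0 (1 / 2 ^ n) 0 1"
    moreover obtain u v where x: "x = (u, v)" by (cases x)
    ultimately have "0 < bspline p n k u" "0 < v / u" "v / u < 1"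
      using k K by (auto intro!: bspline_pos simp: wedge_def)
    moreover have "l - 1 \<le> k - 1" by (cases rule: hier_index_cases[OF assms(1)]) (use assms(3) in auto)
    ultimately show "hier_basis p n k l x \<noteq> 0"
      using assms(3) Bernstein_pos[of "v / u" "l - 1" "k - 1"] by (simp add: x hier_basis_eq del: zero_less_divide_iff)
  qed
qed

definition knot_wedge :: "nat \<Rightarrow> nat \<Rightarrow> nat \<Rightarrow> nat \<Rightarrow> (real \<times> real) set" where
  "knot_wedge p n k l = wedge (open_knot p n k) (open_knot p n (k + p + 1))
     (open_knot p (level p k) l) (open_knot p (level p k) (l + p + 1))"

lemma knot_wedge_subset_Delta: "knot_wedge p n k l \<subseteq> Delta 1"
  unfolding knot_wedge_def by (intro wedge_subset_Delta open_knot_nonneg open_knot_le_1)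

lemma knot_wedge_subset:
  assumes "(k, l) \<in> hier_index p n" "\<exists>x\<in>\<delta>. hier_basis p n k l x \<noteq> 0" "p + 1 < k"
  shows "knot_wedge p n k l \<subseteq> support_extension p n \<delta>"
  unfolding knot_wedge_def
proof (rule wedge_subset_support_extension[OF assms(1,2)])
  fix x assume *: "x \<in> wedge (open_knot p n k) (open_knot p n (k + p + 1))
     (open_knot p (level p k) l) (open_knot p (level p k) (l + p + 1))"
  obtain u v where x: "x = (u, v)" by (cases x)
  have "open_knot p (level p k) l < v / u" "v / u < open_knot p (level p k) (l + p + 1)"
    using wedge_slope(2,3)[OF open_knot_nonneg *[unfolded x]] by simp_all
  then have "0 < bspline p (level p k) l (v / u)" by (rule bspline_pos)
  moreover have "0 < bspline p n k u" using * x by (intro bspline_pos) (auto simp: wedge_def)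
  ultimately show "hier_basis p n k l x \<noteq> 0" using assms(3) by (simp add: x hier_basis_eq)
qed (rule knot_wedge_subset_Delta[unfolded knot_wedge_def])

text \<open>At most \<open>p + 1\<close> values of k are active, and \<open>p + 1\<close> values of
  l for each: in the tip because \<open>l \<le> k \<le> p + 1\<close>, elsewhere because the slopes
  of the cell lie in one knot interval of level \<open>level p k\<close>.\<close>

lemma active_card_le:
  assumes "m \<le> n" "1 \<le> a" "a \<le> 2 ^ m" "1 \<le> c"
  shows "card {(k, l) \<in> hier_index p n. \<exists>x\<in>cell n m a c. hier_basis p n k l x \<noteq> 0} \<le> (p + 1)\<^sup>2"
    (is "card ?A \<le> _")
proof -
  \<comment> \<open>index of the knot interval of level \<open>level p k\<close> containing the \<open>c\<close>-th one of level \<open>m\<close>\<close>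
  define c' where "c' k = (c - 1) div 2 ^ (m - level p k) + 1" for k
  define L where "L k = (if k \<le> p + 1 then {1..p + 1} else {c' k..c' k + p})" for k
  have "?A \<subseteq> Sigma {a..a + p} L"
  proof
    fix i assume "i \<in> ?A"
    then obtain k l u v where i: "i = (k, l)" and kl: "(k, l) \<in> hier_index p n"
      and uv: "(u, v) \<in> cell n m a c" and nz: "hier_basis p n k l (u, v) \<noteq> 0"
      by auto
    have "bspline p n k u \<noteq> 0" using nz by (auto simp: hier_basis_eq)
    then have k: "a \<le> k" "k \<le> a + p"
      using bspline_active[of p n k u a] uv assms(2) hier_index_le[OF kl] by (auto simp: cell_def wedge_def)
    have "l \<in> L k"
      using kl
    proof (cases rule: hier_index_cases)
      case tip
      then show ?thesis by (simp add: L_def)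
    next
      case (body m')
      \<comment> \<open>An active k is at most \<open>a + p\<close>, hence at most
        \<open>2 ^ m + p\<close>. So the level of k does not exceed the slope level of the cell, and
        the knots of level m' are among the cell boundaries of level m.\<close>
      have "p + 2 ^ (m' - 1) < p + (2::nat) ^ m" using body(4) k(2) assms(3) by linarith
      then have "(2::nat) ^ (m' - 1) < 2 ^ m" by simp
      then have "m' - 1 < m" by (rule power_less_imp_less_exp[rotated]) simp
      then have m': "m' \<le> m" using body(2) by simp
      define r where "r = m - m'"
      have mr: "m = m' + r" using m' by (simp add: r_def)
      have c': "c' k = (c - 1) div 2 ^ r + 1" by (simp add: c'_def r_def body(1))
      have "(c - 1) div 2 ^ r * 2 ^ r \<le> c - 1" by simp
      then have "real ((c - 1) div 2 ^ r * 2 ^ r) \<le> real (c - 1)" by (subst of_nat_le_iff)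
      then have lo: "(real (c' k) - 1) * 2 ^ r \<le> real c - 1" using assms(4) by (simp add: c' of_nat_diff)
      have "c - 1 < ((c - 1) div 2 ^ r + 1) * 2 ^ r"
        using dividend_less_div_times[of "2 ^ r" "c - 1"] by simp
      then have "c \<le> c' k * 2 ^ r" by (simp add: c')
      then have "real c \<le> real (c' k * 2 ^ r)" by (subst of_nat_le_iff)
      then have hi: "real c \<le> real (c' k) * 2 ^ r" by simp
      have t: "(real c - 1) / 2 ^ m < v / u" "v / u < real c / 2 ^ m"
        using wedge_slope[of "(real a - 1) / 2 ^ n" u v] uv assms(2) by (simp_all add: cell_def)
      have eq: "y / 2 ^ m' = (y * 2 ^ r) / 2 ^ m" for y :: real by (simp add: mr power_add)
      have "(real (c' k) - 1) / 2 ^ m' \<le> (real c - 1) / 2 ^ m" "real c / 2 ^ m \<le> real (c' k) / 2 ^ m'"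
        unfolding eq using lo hi by (intro divide_right_mono; simp)+
      moreover have "bspline p m' l (v / u) \<noteq> 0" using nz body by (auto simp: hier_basis_eq)
      moreover have "1 \<le> c' k" by (simp add: c')
      ultimately have "c' k \<le> l" "l \<le> c' k + p"
        using bspline_active[of p m' l "v / u" "c' k"] t body(7) by (simp_all add: add.commute)
      then show ?thesis using body by (simp add: L_def)
    qed
    then show "i \<in> Sigma {a..a + p} L" using k by (simp add: i)
  qed
  then have "card ?A \<le> card (Sigma {a..a + p} L)"
    by (rule card_mono[rotated]) (auto simp: L_def)
  also have "\<dots> = (\<Sum>k\<in>{a..a + p}. card (L k))"
    by (rule card_SigmaI) (auto simp: L_def)
  also have "\<dots> = (\<Sum>k\<in>{a..a + p}. p + 1)"
    by (intro sum.cong) (auto simp: L_def)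
  also have "\<dots> = (p + 1)\<^sup>2" by (simp add: power2_eq_square)
  finally show ?thesis .
qed

section \<open>Bounds for the functionals and the projection\<close>

text \<open>The support has length at least 2^-n, so the square of |I|^(-1/2) is at most 2^n. The
  passage from the support to the open interval changes no integral.\<close>

lemma dual_functional:
  assumes "bspline_dual_basis p C lam" "1 \<le> k" "k \<le> 2 ^ n + p"
  shows "L2_functional {0<..<1} (C\<^sup>2 * 2 ^ n) (knot_supp p n k) (lam n k)"
  unfolding L2_functional_def
proof (intro conjI ballI)
  let ?I = "supp_in {0<..<1} (bspline p n k)"
  have k: "k \<in> {1..2 ^ n + p}" using assms by simp
  show "linear_on_L2 {0<..<1} (lam n k)"
    using assms(1) k by (auto simp: bspline_dual_basis_def)
  show "knot_supp p n k \<in> sets borel" by (simp add: knot_supp_def)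
  show "knot_supp p n k \<subseteq> {0<..<1}" by (rule knot_supp_subset)
  fix f :: "real \<Rightarrow> real" assume f: "f \<in> L2 {0<..<1}"
  have I: "?I \<in> sets lebesgue" using supp_in_borel[of "{0<..<1}" "bspline p n k"] by simp
  have K: "knot_supp p n k \<in> sets lebesgue" by (simp add: knot_supp_def)
  have fI: "f \<in> L2 ?I" using f I by (rule L2_subset) (auto simp: supp_in_def)
  define \<mu> where "\<mu> = measure lebesgue ?I"
  have \<mu>: "1 / 2 ^ n \<le> \<mu>" unfolding \<mu>_def by (rule measure_supp_in_bspline[OF assms(2,3)])
  have "0 < 1 / (2 ^ n :: real)" by simp
  then have \<mu>0: "0 < \<mu>" using \<mu> by linarith
  have b: "\<bar>lam n k f\<bar> \<le> C * \<mu> powr (- 1 / 2) * L2_norm ?I f"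
    using assms(1) k f unfolding bspline_dual_basis_def \<mu>_def by blast
  have "(lam n k f)\<^sup>2 \<le> (C * \<mu> powr (- 1 / 2) * L2_norm ?I f)\<^sup>2"
    using b by (metis abs_ge_zero power2_abs power_mono)
  also have "\<dots> = C\<^sup>2 * (\<mu> powr (- 1 / 2))\<^sup>2 * (L2_norm ?I f)\<^sup>2"
    by (simp add: power_mult_distrib)
  also have "(\<mu> powr (- 1 / 2))\<^sup>2 = 1 / \<mu>"
    using \<mu>0 by (simp add: power2_eq_square powr_add[symmetric] powr_minus_divide)
  also have "C\<^sup>2 * (1 / \<mu>) * (L2_norm ?I f)\<^sup>2 \<le> C\<^sup>2 * 2 ^ n * (L2_norm ?I f)\<^sup>2"
  proof (intro mult_right_mono mult_left_mono)
    show "1 / \<mu> \<le> 2 ^ n" using \<mu> \<mu>0 by (simp add: field_simps)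
  qed simp_all
  finally have "ennreal ((lam n k f)\<^sup>2) \<le> ennreal (C\<^sup>2 * 2 ^ n * (L2_norm ?I f)\<^sup>2)"
    by (rule ennreal_leI)
  also have "\<dots> = ennreal (C\<^sup>2 * 2 ^ n) * sqint ?I f"
    using fI by (simp add: sqint_L2 ennreal_mult)
  also have "sqint ?I f = sqint (knot_supp p n k) f"
    unfolding sqint_eq[OF I] sqint_eq[OF K]
    by (rule nn_integral_cong_AE)
       (use AE_supp_in_bspline[of p n k] in \<open>auto simp: indicator_def elim!: eventually_mono\<close>)
  finally show "ennreal ((lam n k f)\<^sup>2) \<le> ennreal (C\<^sup>2 * 2 ^ n) * sqint (knot_supp p n k) f" .
qed simp

lemma body_functional_le:
  assumes dual: "bspline_dual_basis p C lam" and \<phi>: "\<phi> \<in> L2 (Delta 1)"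
    and kl: "(k, l) \<in> hier_index p n" "p + 1 < k"
  shows "\<bar>hier_functional p lam mu n k l \<phi>\<bar> \<le> 2 * C\<^sup>2 * 2 ^ n * L2_norm (knot_wedge p n k l) \<phi>"
proof -
  obtain m where m: "m = level p k" "1 \<le> m" "m \<le> n" "p + 2 ^ (m - 1) + 1 \<le> k" "k \<le> p + 2 ^ m"
    "1 \<le> l" "l \<le> p + 2 ^ m"
    using kl by (auto elim: hier_index_cases)
  let ?I = "supp_in {0<..<1} (bspline p n k)" and ?J = "supp_in {0<..<1} (bspline p m l)"
  let ?K = "knot_supp p n k" and ?L = "knot_supp p m l"
  \<comment> \<open>The extension by zero from \<open>tensor_functional\<close>, as a function on
    the plane.\<close>
  define f where "f x = (if fst x \<in> ?I \<and> snd x \<in> ?J then \<phi> (sing_map x) else 0)" for x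
  have F: "L2_functional {0<..<1} (C\<^sup>2 * 2 ^ n) ?K (lam n k)"
    using hier_index_le[OF kl(1)] by (intro dual_functional[OF dual])
  have G: "L2_functional {0<..<1} (C\<^sup>2 * 2 ^ m) ?L (lam m l)"
    using m by (intro dual_functional[OF dual]) auto
  \<comment> \<open>The smallest s in the support. As k exceeds p + 2^(m - 1), this knot is at least
    2^(m - 1) / 2^n, in particular positive, so the density 1 / s stays bounded.\<close>
  define \<alpha> where "\<alpha> = open_knot p n k"
  have "2 ^ (m - 1) \<le> real k - real p - 1"
  proof -
    have "real (p + 2 ^ (m - 1) + 1) \<le> real k" using m(4) by (subst of_nat_le_iff)
    then show ?thesis by simp
  qed
  also have "\<dots> \<le> \<alpha> * 2 ^ n" unfolding \<alpha>_def
    using hier_index_le[OF kl(1)] by (intro open_knot_lower) simp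
  finally have \<alpha>: "2 ^ (m - 1) \<le> \<alpha> * 2 ^ n" .
  have \<alpha>0: "0 < \<alpha>"
  proof -
    have "0 < (2::real) ^ (m - 1)" by simp
    then have "0 < \<alpha> * 2 ^ n" using \<alpha> by linarith
    then show ?thesis by (simp add: zero_less_mult_iff)
  qed
  have W: "knot_wedge p n k l \<in> sets borel" "Delta 1 \<in> sets borel"
    using open_wedge Delta_open by (auto simp: knot_wedge_def)
  have IJ: "?I \<times> ?J \<in> sets borel" by (intro borel_Times supp_in_borel) auto
  have WL: "knot_wedge p n k l \<in> sets lebesgue" "Delta 1 \<in> sets lebesgue" using W by auto
  \<comment> \<open>A Borel representative h of \<open>\<phi>\<close> extended by zero; g is the
    corresponding version of f.\<close>
  have "(\<lambda>x. indicator (Delta 1) x *\<^sub>R \<phi> x) \<in> borel_measurable lebesgue"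
    using L2_measurable[OF \<phi>] WL by (subst borel_measurable_restrict_space_iff[symmetric]) auto
  from completion_ex_borel_measurable_real[OF this]
  obtain h where h: "h \<in> borel_measurable borel" "AE x in lborel. indicator (Delta 1) x *\<^sub>R \<phi> x = h x"
    by auto
  note [measurable] = h(1) W IJ
  define g where "g x = indicator (?I \<times> ?J) x * h (sing_map x)" for x
  have g: "g \<in> borel_measurable borel" unfolding g_def[abs_def] by measurable
  have IJ_D: "sing_map x \<in> Delta 1" "\<alpha> \<le> fst x" if "x \<in> ?I \<times> ?J" for x
  proof -
    obtain s t where x: "x = (s, t)" by (cases x)
    have "s \<in> {0<..<1}" "t \<in> {0<..<1}" "\<alpha> \<le> s"
      using that supp_in_bspline_subset[of p n k] supp_in_bspline_subset[of p m l] by (auto simp: x \<alpha>_def)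
    then show "sing_map x \<in> Delta 1" "\<alpha> \<le> fst x"
      by (simp_all add: x sing_map_def Delta_def)
  qed
  have fg: "AE x in lborel. f x = g x"
    using AE_sing_map[OF h(2)]
  proof eventually_elim
    case (elim x)
    show ?case
    proof (cases "x \<in> ?I \<times> ?J")
      case True
      then have "0 < fst x" "sing_map x \<in> Delta 1" using IJ_D[OF True] \<alpha>0 by auto
      then have "\<phi> (sing_map x) = h (sing_map x)" using elim by simp
      then show ?thesis using True by (auto simp: f_def g_def)
    next
      case False
      then show ?thesis by (auto simp: f_def g_def mem_Times_iff)
    qed
  qed
  have hsq: "(\<integral>\<^sup>+x. ennreal ((h x)\<^sup>2) * indicator V x \<partial>lborel) = sqint V \<phi>"
    if "V \<in> sets lebesgue" "V \<subseteq> Delta 1" for V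
    unfolding sqint_eq[OF that(1)]
    by (rule nn_integral_cong_AE) (use h(2) that(2) in \<open>auto elim!: eventually_mono simp: indicator_def\<close>)
  \<comment> \<open>The change of variables is used first on the full supports for finiteness, then
    on the open knot intervals for the local bound.\<close>
  have "(\<integral>\<^sup>+x. ennreal ((g x)\<^sup>2) \<partial>lborel) =
      (\<integral>\<^sup>+x. ennreal ((h (sing_map x))\<^sup>2) * indicator (?I \<times> ?J) x \<partial>lborel)"
    by (rule nn_integral_cong) (auto simp: g_def indicator_def)
  also have "\<dots> \<le> ennreal (1 / \<alpha>) * (\<integral>\<^sup>+x. ennreal ((h x)\<^sup>2) * indicator (Delta 1) x \<partial>lborel)"
    using IJ_D by (intro nn_integral_sing_map_le[of "\<lambda>x. ennreal ((h x)\<^sup>2)"] \<alpha>0) auto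
  also have "\<dots> < \<infinity>"
    unfolding hsq[OF WL(2) order_refl] using sqint_finite[OF \<phi>] by (simp add: ennreal_mult_less_top)
  finally have fin: "(\<integral>\<^sup>+x. ennreal ((g x)\<^sup>2) \<partial>lborel) < \<infinity>" .
  have KL: "\<alpha> \<le> fst x \<and> sing_map x \<in> knot_wedge p n k l" if "x \<in> ?K \<times> ?L" for x
  proof
    show "\<alpha> \<le> fst x" using that by (auto simp: knot_supp_def \<alpha>_def)
    show "sing_map x \<in> knot_wedge p n k l"
      unfolding knot_wedge_def sing_map_rectangle[OF open_knot_nonneg, symmetric]
      using that by (intro imageI) (simp add: knot_supp_def m(1))
  qed
  have "(\<integral>\<^sup>+x. ennreal ((g x)\<^sup>2) * indicator (?K \<times> ?L) x \<partial>lborel) \<le>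
      (\<integral>\<^sup>+x. ennreal ((h (sing_map x))\<^sup>2) * indicator (?K \<times> ?L) x \<partial>lborel)"
    by (rule nn_integral_mono) (auto simp: g_def indicator_def)
  also have "\<dots> \<le> ennreal (1 / \<alpha>) * (\<integral>\<^sup>+x. ennreal ((h x)\<^sup>2) * indicator (knot_wedge p n k l) x \<partial>lborel)"
    using KL by (intro nn_integral_sing_map_le[of "\<lambda>x. ennreal ((h x)\<^sup>2)"] \<alpha>0) auto
  also have "\<dots> = ennreal (1 / \<alpha>) * sqint (knot_wedge p n k l) \<phi>"
    by (simp only: hsq[OF WL(1) knot_wedge_subset_Delta])
  finally have gle: "(\<integral>\<^sup>+x. ennreal ((g x)\<^sup>2) * indicator (?K \<times> ?L) x \<partial>lborel) \<le>
      ennreal (1 / \<alpha>) * sqint (knot_wedge p n k l) \<phi>" .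
  have Lam: "hier_functional p lam mu n k l \<phi> = lam n k (\<lambda>s. lam m l (\<lambda>t. f (s, t)))"
    using kl(2) by (simp add: hier_functional_def tensor_functional_def f_def m(1) cong: if_cong)
  have mult3: "ennreal (x * y * z) = ennreal x * ennreal y * ennreal z"
    if "0 \<le> x" "0 \<le> y" "0 \<le> z" for x y z
    using that by (simp add: ennreal_mult)
  have "{0<..<1::real} \<in> lmeasurable" by simp
  from tensor_functional_bound[OF F G this g fg fin]
  have "ennreal ((hier_functional p lam mu n k l \<phi>)\<^sup>2) \<le>
      ennreal (C\<^sup>2 * 2 ^ n) * ennreal (C\<^sup>2 * 2 ^ m) * (\<integral>\<^sup>+x. ennreal ((g x)\<^sup>2) * indicator (?K \<times> ?L) x \<partial>lborel)"
    by (simp only: Lam)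
  also have "\<dots> \<le> ennreal (C\<^sup>2 * 2 ^ n) * ennreal (C\<^sup>2 * 2 ^ m) * (ennreal (1 / \<alpha>) * sqint (knot_wedge p n k l) \<phi>)"
    by (intro mult_left_mono gle) simp
  also have "\<dots> = ennreal (C\<^sup>2 * 2 ^ n * (C\<^sup>2 * 2 ^ m) * (1 / \<alpha>)) * sqint (knot_wedge p n k l) \<phi>"
    using mult3[of "C\<^sup>2 * 2 ^ n" "C\<^sup>2 * 2 ^ m" "1 / \<alpha>"] \<alpha>0 by (simp add: mult.assoc)
  also have "\<dots> \<le> ennreal ((2 * C\<^sup>2 * 2 ^ n)\<^sup>2) * sqint (knot_wedge p n k l) \<phi>"
  proof (intro mult_right_mono ennreal_leI)
    have "1 / \<alpha> \<le> 2 ^ n / 2 ^ (m - 1)" using \<alpha> \<alpha>0 by (simp add: field_simps)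
    then have "C\<^sup>2 * 2 ^ n * (C\<^sup>2 * 2 ^ m) * (1 / \<alpha>) \<le> C\<^sup>2 * 2 ^ n * (C\<^sup>2 * 2 ^ m) * (2 ^ n / 2 ^ (m - 1))"
      by (rule mult_left_mono) simp
    \<comment> \<open>The quotient of 2^m by 2^(m - 1) is 2: here the level disappears.\<close>
    also have "\<dots> = 2 * (C\<^sup>2 * 2 ^ n)\<^sup>2"
      using m(2) by (simp add: power2_eq_square power_eq_if[of 2 m])
    also have "\<dots> \<le> (2 * C\<^sup>2 * 2 ^ n)\<^sup>2"
      by (simp add: power_mult_distrib)
    finally show "C\<^sup>2 * 2 ^ n * (C\<^sup>2 * 2 ^ m) * (1 / \<alpha>) \<le> (2 * C\<^sup>2 * 2 ^ n)\<^sup>2" .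
  qed simp
  finally show ?thesis
    by (rule L2_norm_le_sqint) (use L2_subset[OF \<phi> WL knot_wedge_subset_Delta] in simp_all)
qed

text \<open>The scaling maps the fixed domain of \<open>mu\<close> onto
  \<open>Delta (1 / 2 ^ n)\<close>, so one bound K serves all n; the norm gains 1 / c = 2^n /
  2^\<open>start_level p\<close>. The absolute value covers a K of either sign.\<close>

lemma tip_functional_le:
  assumes K: "\<And>f. f \<in> L2 (Delta (1 / 2 ^ start_level p)) \<Longrightarrow>
      \<bar>mu k l f\<bar> \<le> K * L2_norm (Delta (1 / 2 ^ start_level p)) f"
    and \<phi>: "\<phi> \<in> L2 (Delta 1)" and k: "k \<le> p + 1"
  shows "\<bar>hier_functional p lam mu n k l \<phi>\<bar> \<le> \<bar>K\<bar> * 2 ^ n * L2_norm (Delta (1 / 2 ^ n)) \<phi>"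
proof -
  let ?n0 = "start_level p"
  define c :: real where "c = 2 powi (int ?n0 - int n)"
  have c: "0 < c" "c = 2 ^ ?n0 / 2 ^ n" by (simp_all add: c_def power_int_diff)
  have c': "c * (1 / 2 ^ ?n0) = 1 / 2 ^ n" by (simp add: c)
  have "Delta (1 / 2 ^ n) \<subseteq> Delta 1"
  proof -
    have "1 / (2 ^ n :: real) \<le> 1" by simp
    then show ?thesis by (auto simp: Delta_def intro: less_le_trans)
  qed
  then have "\<phi> \<in> L2 (Delta (c * (1 / 2 ^ ?n0)))"
    unfolding c' using Delta_open by (intro L2_subset[OF \<phi>]) auto
  note L = L2_scale_map[OF c(1) this]
  have "\<bar>hier_functional p lam mu n k l \<phi>\<bar> = \<bar>mu k l (\<phi> \<circ> scale_map c)\<bar>"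
    using k by (simp add: hier_functional_def c_def)
  also have "\<dots> \<le> K * L2_norm (Delta (1 / 2 ^ ?n0)) (\<phi> \<circ> scale_map c)"
    by (rule K[OF L(1)])
  also have "\<dots> = K * (1 / c) * L2_norm (Delta (1 / 2 ^ n)) \<phi>"
    unfolding L(2) c' by simp
  also have "\<dots> \<le> \<bar>K\<bar> * 2 ^ n * L2_norm (Delta (1 / 2 ^ n)) \<phi>"
  proof (intro mult_right_mono mult_mono L2_norm_nonneg)
    have "(2::real) ^ n \<le> 2 ^ n * 2 ^ ?n0" by simp
    then show "1 / c \<le> 2 ^ n" by (simp add: c(2) field_simps)
  qed (use c in auto)
  finally show ?thesis .
qed

lemma hier_functional_le:
  assumes dual: "bspline_dual_basis p C lam" and tip: "tip_dual_basis p mu"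
  obtains K where "0 < K" "\<And>n k l \<phi> \<delta>. \<lbrakk>\<phi> \<in> L2 (Delta 1); (k, l) \<in> hier_index p n;
      \<exists>x\<in>\<delta>. hier_basis p n k l x \<noteq> 0\<rbrakk> \<Longrightarrow>
      \<bar>hier_functional p lam mu n k l \<phi>\<bar> \<le> K * 2 ^ n * L2_norm (support_extension p n \<delta>) \<phi>"
proof -
  let ?D = "Delta (1 / 2 ^ start_level p)"
  have "\<forall>k\<in>{1..p + 1}. \<forall>l\<in>{1..k}. \<exists>K. \<forall>f\<in>L2 ?D. \<bar>mu k l f\<bar> \<le> K * L2_norm ?D f"
    using tip unfolding tip_dual_basis_def by blast
  then obtain M where M: "\<And>k l f. k \<in> {1..p + 1} \<Longrightarrow> l \<in> {1..k} \<Longrightarrow> f \<in> L2 ?D \<Longrightarrow>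
      \<bar>mu k l f\<bar> \<le> M k l * L2_norm ?D f"
    by metis
  define T where "T = (SIGMA k:{1..p + 1}. {1..k})"
  have "finite T" by (simp add: T_def)
  \<comment> \<open>Only finitely many tip functionals exist, with bounds independent of n, so their
    sum dominates each. The summand \<open>2 * C\<^sup>2\<close> serves the remaining functionals,
    and 1 makes K positive.\<close>
  define K where "K = 1 + 2 * C\<^sup>2 + (\<Sum>(k, l)\<in>T. \<bar>M k l\<bar>)"
  have sum0: "0 \<le> (\<Sum>(k, l)\<in>T. \<bar>M k l\<bar>)" by (intro sum_nonneg) auto
  show thesis
  proof (rule that)
    have "0 \<le> 2 * C\<^sup>2" by simp
    then show "0 < K" using sum0 unfolding K_def by linarith
  next
    fix n k l \<phi> \<delta>
    assume \<phi>: "\<phi> \<in> L2 (Delta 1)" and kl: "(k, l) \<in> hier_index p n" and nz: "\<exists>x\<in>\<delta>. hier_basis p n k l x \<noteq> 0"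
    let ?E = "support_extension p n \<delta>"
    have E: "?E \<in> sets lebesgue" by (simp add: support_extension_def)
    have \<phi>E: "\<phi> \<in> L2 ?E"
      using E Delta_open support_extension_subset by (intro L2_subset[OF \<phi>]) auto
    \<comment> \<open>Both kinds of functional are brought to one shape: a bound on a measurable R
      inside the support extension, to be enlarged by monotonicity.\<close>
    have "\<exists>R \<kappa>. \<bar>hier_functional p lam mu n k l \<phi>\<bar> \<le> \<kappa> * 2 ^ n * L2_norm R \<phi> \<and>
        0 \<le> \<kappa> \<and> \<kappa> \<le> K \<and> R \<in> sets lebesgue \<and> R \<subseteq> ?E"
      using kl
    proof (cases rule: hier_index_cases)
      case tip
      have "\<bar>M k l\<bar> \<le> (\<Sum>(k, l)\<in>T. \<bar>M k l\<bar>)"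
        using member_le_sum[of "(k, l)" T "\<lambda>(k, l). \<bar>M k l\<bar>"] \<open>finite T\<close> tip by (auto simp: T_def)
      moreover have "0 \<le> 2 * C\<^sup>2" by simp
      ultimately have "\<bar>M k l\<bar> \<le> K" unfolding K_def by linarith
      moreover have "\<bar>hier_functional p lam mu n k l \<phi>\<bar> \<le> \<bar>M k l\<bar> * 2 ^ n * L2_norm (Delta (1 / 2 ^ n)) \<phi>"
        using tip by (intro tip_functional_le M \<phi>) auto
      moreover have "Delta (1 / 2 ^ n) \<subseteq> ?E" using kl nz tip(2) by (rule tip_wedge_subset)
      moreover have "Delta (1 / 2 ^ n) \<in> sets lebesgue" using Delta_open by auto
      ultimately show ?thesis by (intro exI[of _ "Delta (1 / 2 ^ n)"] exI[of _ "\<bar>M k l\<bar>"]) simp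
    next
      case (body m)
      have "knot_wedge p n k l \<in> sets lebesgue" using open_wedge by (auto simp: knot_wedge_def)
      moreover have "2 * C\<^sup>2 \<le> K" using sum0 by (simp add: K_def)
      moreover have "knot_wedge p n k l \<subseteq> ?E" using kl nz body(8) by (rule knot_wedge_subset)
      ultimately show ?thesis
        using body_functional_le[OF dual \<phi> kl body(8), of mu]
        by (intro exI[of _ "knot_wedge p n k l"] exI[of _ "2 * C\<^sup>2"]) simp
    qed
    then obtain R \<kappa> where R: "\<bar>hier_functional p lam mu n k l \<phi>\<bar> \<le> \<kappa> * 2 ^ n * L2_norm R \<phi>"
        "0 \<le> \<kappa>" "\<kappa> \<le> K" "R \<in> sets lebesgue" "R \<subseteq> ?E" by blast
    note R(1)
    also have "\<kappa> * 2 ^ n * L2_norm R \<phi> \<le> K * 2 ^ n * L2_norm ?E \<phi>"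
      using R(2,3) by (intro mult_mono L2_norm_mono_set[OF \<phi>E R(4) E R(5)] L2_norm_nonneg) auto
    finally show "\<bar>hier_functional p lam mu n k l \<phi>\<bar> \<le> K * 2 ^ n * L2_norm ?E \<phi>" .
  qed
qed

theorem theorem7:
  fixes p :: nat and Cp :: real
    and lam :: "nat \<Rightarrow> nat \<Rightarrow> (real \<Rightarrow> real) \<Rightarrow> real"
    and mu :: "nat \<Rightarrow> nat \<Rightarrow> (real \<times> real \<Rightarrow> real) \<Rightarrow> real"
  assumes "p \<ge> 1"
    and "bspline_dual_basis p Cp lam"
    and "tip_dual_basis p mu"
  shows "\<exists>C\<^sub>S>0. \<forall>n\<ge>start_level p. \<forall>\<phi>\<in>L2 (Delta 1). \<forall>\<delta>\<in>hier_mesh n.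
           hier_projection p lam mu n \<phi> \<in> L2 \<delta> \<and>
           L2_norm \<delta> (hier_projection p lam mu n \<phi>)
             \<le> C\<^sub>S * L2_norm (support_extension p n \<delta>) \<phi>"
proof -
  obtain K where K: "0 < K" "\<And>n k l \<phi> \<delta>. \<lbrakk>\<phi> \<in> L2 (Delta 1); (k, l) \<in> hier_index p n;
      \<exists>x\<in>\<delta>. hier_basis p n k l x \<noteq> 0\<rbrakk> \<Longrightarrow>
      \<bar>hier_functional p lam mu n k l \<phi>\<bar> \<le> K * 2 ^ n * L2_norm (support_extension p n \<delta>) \<phi>"
    using hier_functional_le[OF assms(2,3)] by blast
  define C where "C = (real p + 1)\<^sup>2 * K * 4 ^ p"
  have "0 < C" using K(1) by (simp add: C_def)
  moreover have "hier_projection p lam mu n \<phi> \<in> L2 \<delta> \<and>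
      L2_norm \<delta> (hier_projection p lam mu n \<phi>) \<le> C * L2_norm (support_extension p n \<delta>) \<phi>"
    if \<phi>: "\<phi> \<in> L2 (Delta 1)" and \<delta>: "\<delta> \<in> hier_mesh n" for n \<phi> \<delta>
  proof -
    let ?P = "hier_projection p lam mu n \<phi>" and ?N = "L2_norm (support_extension p n \<delta>) \<phi>"
    obtain m a c where mac: "m \<le> n" "1 \<le> a" "a \<le> 2 ^ m" "1 \<le> c" "c \<le> 2 ^ m" "\<delta> = cell n m a c"
      using hier_mesh_cell[OF \<delta>] by blast
    define A where "A = {(k, l) \<in> hier_index p n. \<exists>x\<in>\<delta>. hier_basis p n k l x \<noteq> 0}"
    have cardA: "card A \<le> (p + 1)\<^sup>2"
      unfolding A_def mac(6) by (rule active_card_le[OF mac(1-4)])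
    \<comment> \<open>A pointwise bound on the cell: number of active functions, bound for each
      functional, size of each basis function.\<close>
    define B where "B = (real p + 1)\<^sup>2 * (K * 2 ^ n * ?N * 4 ^ p)"
    have B0: "0 \<le> B" using K(1) by (simp add: B_def L2_norm_nonneg)
    have meas: "?P \<in> borel_measurable borel"
      unfolding hier_projection_def using borel_measurable_hier_basis
      by (auto simp: case_prod_beta intro!: borel_measurable_sum borel_measurable_times)
    have \<delta>D: "\<delta> \<subseteq> Delta 1"
    proof -
      have "real a \<le> real (2 ^ n)" "real c \<le> real (2 ^ m)"
        unfolding of_nat_le_iff using mac(1,3,5) power_increasing[of m n "2::nat"] by linarith+
      then show ?thesis
        unfolding mac(6) cell_def using mac(2,4) by (intro wedge_subset_Delta) auto
    qed
    have bound: "\<bar>?P x\<bar> \<le> B" if x: "x \<in> \<delta>" for x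
    proof -
      let ?t = "\<lambda>(k, l). hier_functional p lam mu n k l \<phi> * hier_basis p n k l x"
      have eq: "?P x = sum ?t A"
        unfolding hier_projection_def
        by (rule sum.mono_neutral_right[OF finite_hier_index]) (use x in \<open>auto simp: A_def\<close>)
      have "\<bar>?P x\<bar> \<le> (\<Sum>i\<in>A. \<bar>?t i\<bar>)" unfolding eq by (rule sum_abs)
      also have "\<dots> \<le> (\<Sum>i\<in>A. K * 2 ^ n * ?N * 4 ^ p)"
      proof (rule sum_mono)
        fix i assume i: "i \<in> A"
        obtain k l where kl: "i = (k, l)" by (cases i)
        have k: "(k, l) \<in> hier_index p n" "\<exists>x\<in>\<delta>. hier_basis p n k l x \<noteq> 0"
          using i by (simp_all add: A_def kl)
        have "x \<in> Delta 1" using x \<delta>D by blast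
        then have "\<bar>hier_functional p lam mu n k l \<phi>\<bar> * \<bar>hier_basis p n k l x\<bar> \<le> K * 2 ^ n * ?N * 4 ^ p"
          using K(1) by (intro mult_mono K(2)[OF \<phi> k] hier_basis_le[OF k(1)]) (simp_all add: L2_norm_nonneg)
        then show "\<bar>?t i\<bar> \<le> K * 2 ^ n * ?N * 4 ^ p"
          by (simp add: kl abs_mult)
      qed
      also have "\<dots> = real (card A) * (K * 2 ^ n * ?N * 4 ^ p)" by simp
      also have "\<dots> \<le> B"
      proof -
        have "real (card A) \<le> real ((p + 1)\<^sup>2)" using cardA by (subst of_nat_le_iff)
        also have "\<dots> = (real p + 1)\<^sup>2" by simp
        finally show ?thesis
          unfolding B_def using K(1) by (intro mult_right_mono) (simp_all add: L2_norm_nonneg)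
      qed
      finally show ?thesis .
    qed
    have em: "emeasure lebesgue \<delta> \<le> ennreal (1 / 4 ^ n)"
      using emeasure_cell_le[OF mac(2-4), of n] open_wedge by (simp add: mac(6) cell_def)
    have \<delta>m: "\<delta> \<in> lmeasurable"
      using em open_wedge by (intro fmeasurableI) (auto simp: mac(6) cell_def intro: le_less_trans)
    note L = L2_bounded[OF \<delta>m meas bound] and sq = sqint_bounded[where f = ?P and c = B, OF \<delta>m bound]
    have "sqint \<delta> ?P \<le> ennreal (B\<^sup>2) * ennreal (1 / 4 ^ n)"
      by (rule order_trans[OF sq mult_left_mono[OF em]]) auto
    \<comment> \<open>The square root of the area contributes 2^-n, which cancels the
      \<open>2 ^ n\<close> in B.\<close>
    moreover have "(2 ^ n)\<^sup>2 = (4 ^ n :: real)"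
      by (simp add: power2_eq_square power_mult_distrib[symmetric])
    ultimately have "ennreal ((L2_norm \<delta> ?P)\<^sup>2) \<le> ennreal ((B / 2 ^ n)\<^sup>2)"
      by (simp only: sqint_L2[OF L] power_divide) (simp add: ennreal_mult[symmetric])
    then have "(L2_norm \<delta> ?P)\<^sup>2 \<le> (B / 2 ^ n)\<^sup>2" by simp
    then have "L2_norm \<delta> ?P \<le> B / 2 ^ n" by (rule power2_le_imp_le) (simp add: B0)
    also have "B / 2 ^ n = C * ?N" by (simp add: B_def C_def)
    finally show ?thesis using L by simp
  qed
  ultimately show ?thesis by blast
qed

end
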